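(* For $k\ge1$ let $S_k$ be the graph with vertex set $\{x_i,y_i:1\le i\le k\}$ and edges $x_iy_j$ exactly when $j=i$ or $j\ge i+2$, and let $S_k^\circ$ be the labelled graph obtained by labelling $x_1,y_1,x_k,y_k$ with the label "white" and all other vertices with the label "black", where white and black are incomparable labels. Then $\{S_k^\circ\}_{k}$ is a canonical labelled infinite antichain for the class of bichain graphs under the labelled induced subgraph ordering.
   Context: A bichain graph is a bipartite graph admitting a bipartition in which each of the two parts can be divided into at most two chains, a chain being a set of vertices whose neighbourhoods are linearly ordered by inclusion. For a quasi-ordered set $(W,\le)$, $(H,k)$ with $k:V(H)\to W$ is a labelled induced subgraph of $(G,\ell)$ with $\ell:V(G)\to W$ if there is an injective $\phi:V(H)\to V(G)$ with $uv\in E(H)\iff \phi(u)\phi(v)\in E(G)$ and $k(v)\le\ell(\phi(v))$ for all $v$. A class of graphs is labelled well-quasi-ordered if for every well-quasi-ordered $(W,\le)$ the $W$-labelled graphs with underlying graphs in the class contain no infinite antichain under this relation. A labelled infinite antichain $\mathcal{A}$ in a hereditary class $\mathcal{C}$ is canonical if every hereditary subclass of $\mathcal{C}$ that contains only finitely many of the underlying unlabelled graphs of $\mathcal{A}$ is labelled well-quasi-ordered.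
   Formalization: The antichain is taken over k ≥ 2 instead of k ≥ 1, because S_1° is a single edge with both ends white and embeds in every S_k°, so the family including k = 1 is not an antichain. *)

theory Defs
  imports Main
begin

type_synonym 'v graph = "'v set \<times> ('v \<times> 'v) set"

definition verts :: "'v graph \<Rightarrow> 'v set" where "verts G = fst G"
definition edges :: "'v graph \<Rightarrow> ('v \<times> 'v) set" where "edges G = snd G"

definition is_graph :: "'v graph \<Rightarrow> bool" where
  "is_graph G \<longleftrightarrow> finite (verts G) \<and> edges G \<subseteq> verts G \<times> verts G
     \<and> (\<forall>u v. (u, v) \<in> edges G \<longrightarrow> (v, u) \<in> edges G)
     \<and> (\<forall>v. (v, v) \<notin> edges G)"

definition nbhd :: "'v graph \<Rightarrow> 'v \<Rightarrow> 'v set" where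
  "nbhd G v = {u. (v, u) \<in> edges G}"

definition is_chain :: "'v graph \<Rightarrow> 'v set \<Rightarrow> bool" where
  "is_chain G X \<longleftrightarrow> (\<forall>u\<in>X. \<forall>v\<in>X. nbhd G u \<subseteq> nbhd G v \<or> nbhd G v \<subseteq> nbhd G u)"

definition bichain :: "'v graph \<Rightarrow> bool" where
  "bichain G \<longleftrightarrow> is_graph G \<and> (\<exists>A B A1 A2 B1 B2.
      A \<union> B = verts G \<and> A \<inter> B = {}
      \<and> (\<forall>u v. (u, v) \<in> edges G \<longrightarrow> (u \<in> A \<and> v \<in> B) \<or> (u \<in> B \<and> v \<in> A))
      \<and> A = A1 \<union> A2 \<and> A1 \<inter> A2 = {} \<and> B = B1 \<union> B2 \<and> B1 \<inter> B2 = {}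
      \<and> is_chain G A1 \<and> is_chain G A2 \<and> is_chain G B1 \<and> is_chain G B2)"

definition bichain_class :: "nat graph set" where
  "bichain_class = {G. bichain G}"

definition induced_sub :: "'v graph \<Rightarrow> 'u graph \<Rightarrow> bool" where
  "induced_sub H G \<longleftrightarrow> (\<exists>\<phi>. inj_on \<phi> (verts H) \<and> \<phi> ` verts H \<subseteq> verts G
     \<and> (\<forall>u\<in>verts H. \<forall>v\<in>verts H. (u, v) \<in> edges H \<longleftrightarrow> (\<phi> u, \<phi> v) \<in> edges G))"

definition hereditary :: "nat graph set \<Rightarrow> bool" where
  "hereditary C \<longleftrightarrow> (\<forall>G\<in>C. \<forall>H. is_graph H \<and> induced_sub H G \<longrightarrow> H \<in> C)"

definition lab_sub :: "('w \<Rightarrow> 'w \<Rightarrow> bool) \<Rightarrow> 'v graph \<times> ('v \<Rightarrow> 'w) \<Rightarrow> 'u graph \<times> ('u \<Rightarrow> 'w) \<Rightarrow> bool" where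
  "lab_sub le Hk Gl \<longleftrightarrow> (case Hk of (H, k) \<Rightarrow> case Gl of (G, l) \<Rightarrow>
     (\<exists>\<phi>. inj_on \<phi> (verts H) \<and> \<phi> ` verts H \<subseteq> verts G
       \<and> (\<forall>u\<in>verts H. \<forall>v\<in>verts H. (u, v) \<in> edges H \<longleftrightarrow> (\<phi> u, \<phi> v) \<in> edges G)
       \<and> (\<forall>v\<in>verts H. le (k v) (l (\<phi> v)))))"

definition qo_on :: "'w set \<Rightarrow> ('w \<Rightarrow> 'w \<Rightarrow> bool) \<Rightarrow> bool" where
  "qo_on W le \<longleftrightarrow> (\<forall>x\<in>W. le x x) \<and> (\<forall>x\<in>W. \<forall>y\<in>W. \<forall>z\<in>W. le x y \<longrightarrow> le y z \<longrightarrow> le x z)"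

definition wqo_on :: "'w set \<Rightarrow> ('w \<Rightarrow> 'w \<Rightarrow> bool) \<Rightarrow> bool" where
  "wqo_on W le \<longleftrightarrow> qo_on W le \<and> (\<forall>f::nat \<Rightarrow> 'w. (\<forall>i. f i \<in> W) \<longrightarrow> (\<exists>i j. i < j \<and> le (f i) (f j)))"

definition labelled_antichain :: "nat graph set \<Rightarrow> 'w set \<Rightarrow> ('w \<Rightarrow> 'w \<Rightarrow> bool)
    \<Rightarrow> (nat graph \<times> (nat \<Rightarrow> 'w)) set \<Rightarrow> bool" where
  "labelled_antichain C W le A \<longleftrightarrow> infinite A
     \<and> (\<forall>(G, l)\<in>A. G \<in> C \<and> l ` verts G \<subseteq> W)
     \<and> (\<forall>a\<in>A. \<forall>b\<in>A. a \<noteq> b \<longrightarrow> \<not> lab_sub le a b)"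

definition labelled_wqo_wrt :: "nat graph set \<Rightarrow> 'w set \<Rightarrow> ('w \<Rightarrow> 'w \<Rightarrow> bool) \<Rightarrow> bool" where
  "labelled_wqo_wrt C W le \<longleftrightarrow> (wqo_on W le \<longrightarrow> \<not> (\<exists>A. labelled_antichain C W le A))"

datatype colour = White | Black

(* S_k: x_i = 2*i, y_i = 2*i+1, for 1 \<le> i \<le> k; edge x_i y_j iff j = i or j \<ge> i+2 *)
definition Sk :: "nat \<Rightarrow> nat graph" where
  "Sk k = ({2 * i | i. 1 \<le> i \<and> i \<le> k} \<union> {2 * i + 1 | i. 1 \<le> i \<and> i \<le> k},
           {(2 * i, 2 * j + 1) | i j. 1 \<le> i \<and> i \<le> k \<and> 1 \<le> j \<and> j \<le> k \<and> (j = i \<or> j \<ge> i + 2)}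
         \<union> {(2 * j + 1, 2 * i) | i j. 1 \<le> i \<and> i \<le> k \<and> 1 \<le> j \<and> j \<le> k \<and> (j = i \<or> j \<ge> i + 2)})"

definition Sk_lab :: "nat \<Rightarrow> nat \<Rightarrow> colour" where
  "Sk_lab k v = (if v \<in> {2, 3, 2 * k, 2 * k + 1} then White else Black)"

end

theory Submission
  imports Defs "HOL-Library.Sublist" "HOL-Library.Infinite_Set"
begin

text \<open>Orient a bipartite graph with parts \<open>A\<close> and \<open>B\<close> by \<open>a \<rightarrow> b\<close> if \<open>a\<close> and \<open>b\<close> are adjacent and \<open>b \<rightarrow> a\<close>
  otherwise. A shortest directed path in this bipartite tournament induces some \<open>S\<^sub>k\<close>, so without a
  large \<open>S\<^sub>k\<close> all directed distances inside a strongly connected component are bounded. The components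
  are linearly ordered, with all arcs between them pointing backwards, and within a component one can
  spiral through the four chains, always passing to the out-neighbours in the next chain. This cuts the
  component into layers that are chains and interact non-trivially only with the two neighbouring
  layers. An arc decreases the layer index by at most one, so the number of layers is bounded, and the
  component is coded by a word over a finite alphabet. Labelled graphs thus become words of words
  over a well-quasi-order, and Higman's lemma applies twice.

  In the other direction, the white labels force an embedding of \<open>S\<^sub>k\<close> into \<open>S\<^sub>m\<close> to match up both
  ends, possibly after the flip \<open>x\<^sub>i \<leftrightarrow> y\<^sub>m\<^sub>+\<^sub>1\<^sub>-\<^sub>i\<close>, and then rigidity forces \<open>k = m\<close>.\<close>

section \<open>Higman's lemma\<close>

text \<open>Only finitely many terms lie below no later term, since infinitely many would form a
  sequence without a good pair. Past all of them successors can be chosen forever, and transitivity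
  compares any two chosen terms.\<close>

lemma wqo_on_ascending_subsequence:
  fixes f :: "nat \<Rightarrow> 'a"
  assumes wqo: "wqo_on W le" and f: "\<And>i. f i \<in> W"
  shows "\<exists>g :: nat \<Rightarrow> nat. strict_mono g \<and> (\<forall>i j. i < j \<longrightarrow> le (f (g i)) (f (g j)))"
proof -
  define N where "N = {i. \<forall>j>i. \<not> le (f i) (f j)}"
  have "finite N"
  proof (rule ccontr)
    assume inf: "infinite N"
    let ?e = "enumerate N"
    have "\<forall>i. f (?e i) \<in> W" using f by simp
    then obtain i j where ij: "i < j" "le (f (?e i)) (f (?e j))"
      using wqo unfolding wqo_on_def by meson
    have "?e i < ?e j" using ij(1) inf by (rule enumerate_mono)
    moreover have "?e i \<in> N" using inf by (rule enumerate_in_set)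
    ultimately show False using ij(2) unfolding N_def by blast
  qed
  then obtain m where m: "\<forall>i\<in>N. i < m"
    unfolding finite_nat_set_iff_bounded by blast
  have next_ge: "\<exists>j>i. le (f i) (f j)" if "i \<ge> m" for i
  proof -
    have "i \<notin> N" using m that by (metis leD)
    then show ?thesis by (simp add: N_def)
  qed
  have "\<exists>g. \<forall>n. g n \<ge> m \<and> (g n < g (Suc n) \<and> le (f (g n)) (f (g (Suc n))))"
  proof (rule dependent_nat_choice)
    fix i n :: nat assume "m \<le> i"
    then obtain j where "i < j" "le (f i) (f j)" using next_ge by blast
    then show "\<exists>j. m \<le> j \<and> i < j \<and> le (f i) (f j)" using \<open>m \<le> i\<close> by (intro exI[of _ j]) simp
  qed blast
  then obtain g where g: "\<And>n. g n < g (Suc n)" "\<And>n. le (f (g n)) (f (g (Suc n)))"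
    by blast
  have "le (f (g i)) (f (g j))" if "i < j" for i j
    using that
  proof (induction j)
    case (Suc j)
    show ?case
    proof (cases "i = j")
      case False
      then have "le (f (g i)) (f (g j))" using Suc by simp
      then show ?thesis using g(2)[of j] f wqo unfolding wqo_on_def qo_on_def by blast
    qed (use g in simp)
  qed simp
  moreover have "strict_mono g" using g(1) by (simp add: strict_mono_Suc_iff)
  ultimately show ?thesis by blast
qed

text \<open>Nash-Williams' minimal bad sequence argument.\<close>

lemma higman:
  assumes wqo: "wqo_on W le"
  shows "wqo_on (lists W) (list_emb le)"
proof -
  have refl: "le x x" if "x \<in> W" for x
    using wqo that unfolding wqo_on_def qo_on_def by blast
  have trans: "le x z" if "x \<in> W" "y \<in> W" "z \<in> W" "le x y" "le y z" for x y z
    using wqo that unfolding wqo_on_def qo_on_def by blast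
  have "list_emb le xs xs" if "xs \<in> lists W" for xs
    using that refl by (auto intro: list_emb_refl)
  moreover have "list_emb le xs zs"
    if "xs \<in> lists W" "ys \<in> lists W" "zs \<in> lists W" "list_emb le xs ys" "list_emb le ys zs" for xs ys zs
    using list_emb_trans[of xs ys zs le] that trans by (metis in_lists_conv_set)
  ultimately have qo: "qo_on (lists W) (list_emb le)"
    unfolding qo_on_def by blast
  define bad where "bad f \<longleftrightarrow> (\<forall>i. f i \<in> lists W) \<and> (\<forall>i j. i < j \<longrightarrow> \<not> list_emb le (f i) (f j))"
    for f :: "nat \<Rightarrow> 'a list"
  have False if "bad f0" for f0
  proof -
    \<comment> \<open>\<open>ext ps\<close> says that \<open>ps\<close> is an initial segment of
      some bad sequence.\<close>
    define ext where "ext ps \<longleftrightarrow> (\<exists>f. bad f \<and> (\<forall>i<length ps. f i = ps ! i))" for ps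
    have step: "\<exists>x. ext (ps @ [x]) \<and> (\<forall>y. ext (ps @ [y]) \<longrightarrow> length x \<le> length y)" if "ext ps" for ps
    proof -
      obtain f where f: "bad f" "\<forall>i<length ps. f i = ps ! i" using \<open>ext ps\<close> unfolding ext_def by blast
      have "ext (ps @ [f (length ps)])"
        unfolding ext_def using f by (intro exI[of _ f]) (auto simp: nth_append less_Suc_eq)
      then show ?thesis
        using ex_has_least_nat[of "\<lambda>x. ext (ps @ [x])" _ length] by blast
    qed
    \<comment> \<open>\<open>p n\<close> collects the first \<open>n\<close> entries of the minimal
      bad sequence; each new entry is as short as possible among all continuations to a bad
      sequence.\<close>
    have "\<exists>p. \<forall>n. (ext (p n) \<and> length (p n) = n) \<and>
        (\<exists>x. p (Suc n) = p n @ [x] \<and> (\<forall>y. ext (p n @ [y]) \<longrightarrow> length x \<le> length y))"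
    proof (rule dependent_nat_choice)
      show "\<exists>x. ext x \<and> length x = 0" using \<open>bad f0\<close> unfolding ext_def by auto
    next
      fix ps n assume "ext ps \<and> length ps = n"
      then show "\<exists>y. (ext y \<and> length y = Suc n) \<and>
          (\<exists>x. y = ps @ [x] \<and> (\<forall>y. ext (ps @ [y]) \<longrightarrow> length x \<le> length y))"
        using step[of ps] by (metis length_append_singleton)
    qed
    then obtain p x where p: "\<And>n. ext (p n)" "\<And>n. length (p n) = n"
      and Suc: "\<And>n. p (Suc n) = p n @ [x n]"
      and min: "\<And>n y. ext (p n @ [y]) \<Longrightarrow> length (x n) \<le> length y"
      by metis
    have nth: "p n ! i = x i" if "i < n" for i n
      using that by (induction n) (auto simp: Suc nth_append p less_Suc_eq)
    have bad_x: "bad x"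
    proof -
      have "x i \<in> lists W" for i
        using p(1)[of "Suc i"] p(2)[of "Suc i"] nth[of i "Suc i"] unfolding ext_def bad_def
        by (metis lessI)
      moreover have "\<not> list_emb le (x i) (x j)" if "i < j" for i j
        using p(1)[of "Suc j"] p(2)[of "Suc j"] nth[of i "Suc j"] nth[of j "Suc j"] that
        unfolding ext_def bad_def by (metis lessI less_SucI)
      ultimately show ?thesis unfolding bad_def by blast
    qed
    have ne: "x i \<noteq> []" for i
      using bad_x unfolding bad_def by (metis lessI list_emb_Nil)
    have inW: "x i \<in> lists W" for i using bad_x unfolding bad_def by blast
    have hdW: "hd (x i) \<in> W" for i using inW[of i] ne[of i] by (cases "x i") auto
    have tlW: "tl (x i) \<in> lists W" for i using inW[of i] ne[of i] by (cases "x i") auto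
    obtain g :: "nat \<Rightarrow> nat" where g: "strict_mono g" "\<And>i j. i < j \<Longrightarrow> le (hd (x (g i))) (hd (x (g j)))"
      using wqo_on_ascending_subsequence[of W le "\<lambda>i. hd (x i)", OF wqo hdW] by blast
    define m where "m = g 0"
    \<comment> \<open>Keep the entries before \<open>m = g 0\<close> and continue with the tails
      along \<open>g\<close>. A good pair of \<open>y\<close> would give one of \<open>x\<close>: a
      tail embeds in its word, and the increasing heads can be put back on two tails.\<close>
    define y where "y i = (if i < m then x i else tl (x (g (i - m))))" for i
    have "bad y"
    proof -
      have "\<not> list_emb le (y i) (y j)" if ij: "i < j" for i j
      proof
        assume emb: "list_emb le (y i) (y j)"
        consider "j < m" | "i < m" "j \<ge> m" | "i \<ge> m" using ij by linarith
        then show False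
        proof cases
          case 1
          then show False using emb ij bad_x unfolding y_def bad_def by auto
        next
          case 2
          have "list_emb le (x i) (tl (x (g (j - m))))" using 2 emb by (simp add: y_def)
          then have "list_emb le (x i) (x (g (j - m)))"
            using ne[of "g (j - m)"] by (metis list_emb_Cons list.collapse)
          moreover have "m \<le> g (j - m)" using g(1) unfolding m_def
            by (simp add: strict_mono_less_eq)
          ultimately show False using 2 bad_x unfolding bad_def by (metis order_less_le_trans)
        next
          case 3
          then have "list_emb le (tl (x (g (i - m)))) (tl (x (g (j - m))))" using emb ij by (simp add: y_def)
          moreover have "le (hd (x (g (i - m)))) (hd (x (g (j - m))))" using g(2) 3 ij by simp
          ultimately have "list_emb le (x (g (i - m))) (x (g (j - m)))"
            using ne by (metis list_emb_Cons2 list.collapse)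
          moreover have "g (i - m) < g (j - m)" using g(1) 3 ij by (simp add: strict_mono_less)
          ultimately show False using bad_x unfolding bad_def by blast
        qed
      qed
      moreover have "y i \<in> lists W" for i using inW tlW by (simp add: y_def)
      ultimately show ?thesis unfolding bad_def by blast
    qed
    \<comment> \<open>\<open>y\<close> agrees with \<open>x\<close> on the first \<open>m\<close>
      entries, but its next entry \<open>tl (x m)\<close> is shorter than the minimal one.\<close>
    moreover have "\<forall>i<Suc m. y i = (p m @ [tl (x m)]) ! i"
      by (auto simp: y_def nth_append p nth less_Suc_eq m_def)
    ultimately have "ext (p m @ [tl (x m)])"
      unfolding ext_def using p(2) by (intro exI[of _ y]) simp
    then have "length (x m) \<le> length (tl (x m))" by (rule min)
    then show False using ne[of m] by (cases "x m") auto
  qed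
  then have "\<exists>i j. i < j \<and> list_emb le (f i) (f j)" if "\<forall>i. f i \<in> lists W" for f :: "nat \<Rightarrow> 'a list"
    using that unfolding bad_def by blast
  then show ?thesis using qo unfolding wqo_on_def by blast
qed

text \<open>By pigeonhole, the first component is constant on an infinite set of indices, and
  \<open>W\<close> provides a good pair along the enumeration of this set.\<close>

lemma wqo_on_finite_letters_Times:
  assumes wqo: "wqo_on W le" and fin: "finite L"
  shows "wqo_on (L \<times> W) (\<lambda>a b. fst a = fst b \<and> le (snd a) (snd b))"
proof -
  have "\<exists>i j. i < j \<and> fst (f i) = fst (f j) \<and> le (snd (f i)) (snd (f j))"
    if f: "\<forall>i. f i \<in> L \<times> W" for f :: "nat \<Rightarrow> 'b \<times> 'a"
  proof -
    have "(fst \<circ> f) ` UNIV \<subseteq> L" using f by (auto simp: mem_Times_iff)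
    then have "finite ((fst \<circ> f) ` UNIV)" using fin by (rule finite_subset)
    then obtain a where "infinite {i. (fst \<circ> f) i = (fst \<circ> f) a}"
      using pigeonhole_infinite[OF infinite_UNIV_nat] by auto
    then have inf: "infinite {i. fst (f i) = fst (f a)}" (is "infinite ?I") by simp
    have "\<forall>i. snd (f (enumerate ?I i)) \<in> W" using f by (auto simp: mem_Times_iff)
    then obtain i j where "i < j" "le (snd (f (enumerate ?I i))) (snd (f (enumerate ?I j)))"
      using wqo unfolding wqo_on_def by meson
    moreover have "enumerate ?I i < enumerate ?I j" using \<open>i < j\<close> inf by (rule enumerate_mono)
    moreover have "fst (f (enumerate ?I n)) = fst (f a)" for n
      using enumerate_in_set[OF inf, of n] by simp
    ultimately show ?thesis by metis
  qed
  moreover have "qo_on (L \<times> W) (\<lambda>a b. fst a = fst b \<and> le (snd a) (snd b))"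
    using wqo unfolding wqo_on_def qo_on_def by (metis mem_Times_iff)
  ultimately show ?thesis unfolding wqo_on_def by blast
qed

text \<open>Turns a list embedding into a map of positions, so that the order of two entries can be
  compared in both lists.\<close>

lemma list_emb_strict_mono:
  assumes "list_emb P xs ys"
  shows "\<exists>f. strict_mono_on {..<length xs} f \<and> (\<forall>i<length xs. f i < length ys \<and> P (xs ! i) (ys ! f i))"
  using assms
proof induction
  case (list_emb_Nil ys)
  show ?case by (simp add: strict_mono_on_def)
next
  case (list_emb_Cons xs ys y)
  then obtain f where f: "strict_mono_on {..<length xs} f"
    "\<forall>i<length xs. f i < length ys \<and> P (xs ! i) (ys ! f i)" by blast
  then show ?case by (intro exI[of _ "\<lambda>i. Suc (f i)"]) (auto simp: strict_mono_on_def)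
next
  case (list_emb_Cons2 x y xs ys)
  then obtain f where f: "strict_mono_on {..<length xs} f"
    "\<forall>i<length xs. f i < length ys \<and> P (xs ! i) (ys ! f i)" by blast
  let ?f = "\<lambda>i. case i of 0 \<Rightarrow> 0 | Suc i \<Rightarrow> Suc (f i)"
  have "?f i < length (y # ys) \<and> P ((x # xs) ! i) ((y # ys) ! ?f i)" if "i < length (x # xs)" for i
    using that f list_emb_Cons2 by (cases i) auto
  moreover have "strict_mono_on {..<length (x # xs)} ?f"
    using f(1) by (auto simp: strict_mono_on_def split: nat.splits)
  ultimately show ?case by blast
qed

lemma list_emb_map_strict_mono:
  assumes "list_emb P (map h xs) (map h' ys)"
  shows "\<exists>f. strict_mono_on {..<length xs} f \<and>
    (\<forall>i<length xs. f i < length ys \<and> P (h (xs ! i)) (h' (ys ! f i)))"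
proof -
  obtain f where f: "strict_mono_on {..<length xs} f"
    "\<And>i. i < length xs \<Longrightarrow> f i < length ys \<and> P (map h xs ! i) (map h' ys ! f i)"
    using list_emb_strict_mono[OF assms] by auto
  have "f i < length ys \<and> P (h (xs ! i)) (h' (ys ! f i))" if "i < length xs" for i
    using f(2)[OF that] that by (metis nth_map)
  then show ?thesis using f(1) by blast
qed

section \<open>Bipartite tournaments\<close>

text \<open>All conditions are relative to \<open>H\<close>, so \<open>side\<close> and
  \<open>arc\<close> can stay the same when \<open>H\<close> shrinks.\<close>

locale bipartite_tournament =
  fixes H :: "'v set" and side :: "'v \<Rightarrow> bool" and arc :: "'v \<Rightarrow> 'v \<Rightarrow> bool"
  assumes finite_H: "finite H"
    and arc_side: "u \<in> H \<Longrightarrow> w \<in> H \<Longrightarrow> arc u w \<Longrightarrow> side u \<noteq> side w"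
    and arc_iff: "u \<in> H \<Longrightarrow> w \<in> H \<Longrightarrow> side u \<noteq> side w \<Longrightarrow> arc u w \<longleftrightarrow> \<not> arc w u"
begin

definition out :: "'v \<Rightarrow> 'v set" where
  "out u = {w \<in> H. arc u w}"

definition out_closed :: "'v set \<Rightarrow> bool" where
  "out_closed X \<longleftrightarrow> X \<subseteq> H \<and> (\<forall>u\<in>X. \<forall>w\<in>H. arc u w \<longrightarrow> w \<in> X)"

text \<open>This is strong connectedness, phrased by the sets along which \<open>H\<close> could be
  split.\<close>

definition indecomposable :: bool where
  "indecomposable \<longleftrightarrow> (\<forall>X. out_closed X \<longrightarrow> X = {} \<or> X = H)"

text \<open>The vertices reachable from \<open>x\<close> form an out-closed set containing
  \<open>x\<close>, hence all of \<open>H\<close>.\<close>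

lemma indecomposable_reach:
  assumes indecomposable and "x \<in> H" "y \<in> H"
  shows "(x, y) \<in> {(u, w). u \<in> H \<and> w \<in> H \<and> arc u w}\<^sup>*"
proof -
  let ?E = "{(u, w). u \<in> H \<and> w \<in> H \<and> arc u w}"
  have "{y. (x, y) \<in> ?E\<^sup>*} \<subseteq> H"
    using \<open>x \<in> H\<close> by (auto elim: rtranclE)
  then have "out_closed {y. (x, y) \<in> ?E\<^sup>*}"
    unfolding out_closed_def by (auto intro: rtrancl_into_rtrancl)
  then show ?thesis using assms unfolding indecomposable_def by blast
qed

end

text \<open>For the least length \<open>m\<close>, a shortcut or a repeated vertex would splice a
  walk from \<open>x\<close> and a walk to \<open>y\<close> into a shorter one.\<close>

lemma shortest_path:
  assumes "(x, y) \<in> E\<^sup>*"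
  obtains f :: "nat \<Rightarrow> 'a" and m where "f 0 = x" "f m = y" "\<And>i. i < m \<Longrightarrow> (f i, f (Suc i)) \<in> E"
    "\<And>i j. i + 2 \<le> j \<Longrightarrow> j \<le> m \<Longrightarrow> (f i, f j) \<notin> E" "inj_on f {..m}"
proof -
  define m where "m = (LEAST n. (x, y) \<in> E ^^ n)"
  have "\<exists>n. (x, y) \<in> E ^^ n" using assms by (simp add: rtrancl_is_UN_relpow)
  then have m: "(x, y) \<in> E ^^ m" unfolding m_def by (metis LeastI)
  have m_le: "m \<le> n" if "(x, y) \<in> E ^^ n" for n unfolding m_def using that by (rule Least_le)
  obtain f where f: "f 0 = x" "f m = y" "\<And>i. i < m \<Longrightarrow> (f i, f (Suc i)) \<in> E"
    using m unfolding relpow_fun_conv by blast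
  have from_x: "(x, f i) \<in> E ^^ i" if "i \<le> m" for i
    unfolding relpow_fun_conv using that f by (intro exI[of _ f]) simp
  have to_y: "(f i, y) \<in> E ^^ (m - i)" if "i \<le> m" for i
    unfolding relpow_fun_conv using that f by (intro exI[of _ "\<lambda>j. f (i + j)"]) simp
  have "(f i, f j) \<notin> E" if "i + 2 \<le> j" "j \<le> m" for i j
  proof
    assume "(f i, f j) \<in> E"
    then have "(x, f j) \<in> E ^^ Suc i" using from_x[of i] that by auto
    then have "(x, y) \<in> E ^^ (Suc i + (m - j))"
      unfolding relpow_add using to_y[of j] that by auto
    then show False using m_le that by fastforce
  qed
  moreover have "f i \<noteq> f j" if "i < j" "j \<le> m" for i j
  proof
    assume "f i = f j"
    then have "(x, f j) \<in> E ^^ i" using from_x[of i] that by simp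
    then have "(x, y) \<in> E ^^ (i + (m - j))"
      unfolding relpow_add using to_y[of j] that by auto
    then show False using m_le that by fastforce
  qed
  then have "inj_on f {..m}" by (metis atMost_iff inj_onI linorder_neqE_nat)
  ultimately show thesis using f that by blast
qed

section \<open>Layers\<close>

lemma less_4_cases: "(n::nat) < 4 \<Longrightarrow> n = 0 \<or> n = 1 \<or> n = 2 \<or> n = 3"
  by arith

lemma even_mod_4_iff: "even ((n::nat) mod 4) \<longleftrightarrow> even n"
  by presburger

lemma odd_add_mod_4_cases:
  fixes a b :: nat
  assumes "odd (a + b)"
  shows "b mod 4 = (a + 1) mod 4 \<or> a mod 4 = (b + 1) mod 4"
proof -
  have ab: "odd (a mod 4 + b mod 4)" using assms by presburger
  have "b mod 4 = (a mod 4 + 1) mod 4 \<or> a mod 4 = (b mod 4 + 1) mod 4"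
    using ab less_4_cases[of "a mod 4"] less_4_cases[of "b mod 4"] by auto
  then show ?thesis by (simp add: mod_simps)
qed

text \<open>The difference is odd, so it is 1 or 3 modulo 4; as it is at least 3, residue 1 means at
  least 5.\<close>

lemma odd_add_mod_4_far:
  fixes a b :: nat
  assumes "odd (a + b)" "a + 3 \<le> b"
  shows "b mod 4 = (a + 5) mod 4 \<and> a + 5 \<le> b \<or> b mod 4 = (a + 3) mod 4"
proof -
  have mod: "(a + k) mod 4 = (a mod 4 + k) mod 4" for k by (simp add: mod_add_left_eq)
  have 1: "(a + 5) mod 4 = (a + 1) mod 4"
    unfolding mod using less_4_cases[of "a mod 4"] by auto
  have 2: "(a + 3) mod 4 = b mod 4" if "a mod 4 = (b + 1) mod 4"
    using mod_add_cong[OF that, of 3 3] by simp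
  have "(a + 3) mod 4 \<noteq> (a + 1) mod 4" "(a + 4) mod 4 \<noteq> (a + 1) mod 4"
    unfolding mod using less_4_cases[of "a mod 4"] by auto
  then have "b \<noteq> a + 3" "b \<noteq> a + 4" if "b mod 4 = (a + 1) mod 4" using that by metis+
  then have "a + 5 \<le> b" if "b mod 4 = (a + 1) mod 4" using that assms(2) by linarith
  then show ?thesis using odd_add_mod_4_cases[OF assms(1)] 1 2 by metis
qed

section \<open>Cutting the four chains along a spiral\<close>

locale spiral = bipartite_tournament +
  fixes c :: "'a \<Rightarrow> nat"
  assumes c_less: "v \<in> H \<Longrightarrow> c v < 4"
    and side_c: "v \<in> H \<Longrightarrow> side v \<longleftrightarrow> even (c v)"
    and chain: "u \<in> H \<Longrightarrow> w \<in> H \<Longrightarrow> c u = c w \<Longrightarrow> out u \<subseteq> out w \<or> out w \<subseteq> out u"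
begin

text \<open>Each \<open>T i\<close> is a down-set of the chain \<open>i mod 4\<close> (ordered by out-neighbourhoods). The cuts
  \<open>T i\<close>, \<open>T (i + 1)\<close> of two consecutive chains are consistent with all arcs between these chains.\<close>

fun T :: "nat \<Rightarrow> 'a set" where
  "T i = (if i < 4 then {v \<in> H. c v = i} else {w \<in> H. c w = i mod 4 \<and> (\<exists>u\<in>T (i - 1). arc u w)})"

declare T.simps [simp del]

lemma T_less: "i < 4 \<Longrightarrow> T i = {v \<in> H. c v = i}"
  by (simp add: T.simps)

lemma T_Suc: "3 \<le> i \<Longrightarrow> T (Suc i) = {w \<in> H. c w = Suc i mod 4 \<and> (\<exists>u\<in>T i. arc u w)}"
  by (simp add: T.simps[of "Suc i"])

lemma T_subset: "T i \<subseteq> {v \<in> H. c v = i mod 4}"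
  by (subst T.simps) auto

text \<open>Some \<open>u\<close> in the previous cut has an arc to \<open>w\<close> but none to
  \<open>w'\<close>. So \<open>u\<close> is an out-neighbour of \<open>w'\<close> and not of
  \<open>w\<close>, which decides the direction of the inclusion.\<close>

lemma T_down:
  assumes "w \<in> T i" "w' \<in> H" "c w' = i mod 4" "w' \<notin> T i"
  shows "out w \<subseteq> out w'"
proof -
  \<comment> \<open>For \<open>i < 4\<close> the cut \<open>T i\<close> is a whole chain and leaves
    no room for \<open>w'\<close>.\<close>
  obtain j where i: "i = Suc j" "3 \<le> j"
    using assms T_less[of i] by (cases i) fastforce+
  then obtain u where u: "u \<in> T j" "arc u w" and w: "w \<in> H" "c w = i mod 4"
    using assms(1) by (auto simp: T_Suc)
  have uH: "u \<in> H" "c u = j mod 4" using u T_subset by blast+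
  have "\<not> arc u w'" using assms u i T_Suc by auto
  moreover have "side u \<noteq> side w'" "side u \<noteq> side w"
    using uH side_c assms w i by (auto simp: even_mod_4_iff)
  ultimately have "u \<in> out w'" "u \<notin> out w" 
    using arc_iff[of w' u] arc_iff[of w u] uH assms w u unfolding out_def by blast+
  then show ?thesis using chain[of w w'] assms w by auto
qed

text \<open>The first four cuts are whole chains, and shrinking \<open>T i\<close> can only shrink
  \<open>T (Suc i)\<close>, so the inclusion propagates around the spiral.\<close>

lemma T_add4: "T (i + 4) \<subseteq> T i"
proof (induction i)
  case 0
  then show ?case using T_subset[of 4] by (auto simp: T_less)
next
  case (Suc i)
  show ?case
  proof (cases "3 \<le> i")
    case True
    have "Suc (i + 4) mod 4 = Suc i mod 4" using mod_add_self2[of "Suc i" 4] by simp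
    then show ?thesis using True Suc T_Suc[of i] T_Suc[of "i + 4"] by auto
  next
    case False
    then have "(Suc i + 4) mod 4 = Suc i" by presburger
    then show ?thesis using False T_subset[of "Suc i + 4"] T_less[of "Suc i"] by auto
  qed
qed

lemma T_add_mult4: "T (i + 4 * k) \<subseteq> T i"
proof (induction k)
  case (Suc k)
  have "i + 4 * Suc k = (i + 4 * k) + 4" by simp
  then show ?case using Suc T_add4[of "i + 4 * k"] by (metis order_trans)
qed simp

lemma T_antimono:
  assumes "i \<le> j" "j mod 4 = i mod 4"
  shows "T j \<subseteq> T i"
proof -
  obtain k where "j = i + 4 * k" using assms by (metis mod_eq_nat1E)
  then show ?thesis using T_add_mult4 by simp
qed

text \<open>The vertex \<open>w\<close> entered its cut by an arc from some \<open>u'\<close> in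
  \<open>T i\<close>, and \<open>u\<close> has all out-neighbours of \<open>u'\<close>. Together
  with the next lemma, all arcs across two consecutive cuts lead from outside to inside.\<close>

lemma arc_outside_inside:
  assumes "u \<in> H" "c u = i mod 4" "u \<notin> T i" "w \<in> T (Suc i)"
  shows "arc u w"
proof -
  have i: "3 \<le> i" using assms T_less[of i] by fastforce
  then obtain u' where u': "u' \<in> T i" "arc u' w" and w: "w \<in> H" using assms by (auto simp: T_Suc)
  then have "w \<in> out u'" by (simp add: out_def)
  then have "w \<in> out u" using T_down[of u' i u] u' assms by blast
  then show ?thesis by (simp add: out_def)
qed

text \<open>An arc from \<open>u\<close> to \<open>w\<close> would put \<open>w\<close> into
  \<open>T (Suc i)\<close>.\<close>

lemma arc_outside_inside':
  assumes "u \<in> T i" "w \<in> H" "c w = Suc i mod 4" "w \<notin> T (Suc i)"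
  shows "arc w u"
proof -
  have i: "3 \<le> i" using assms T_less[of "Suc i"] by fastforce
  then have "\<not> arc u w" using assms by (auto simp: T_Suc)
  moreover have u: "u \<in> H" "c u = i mod 4" using assms T_subset by blast+
  moreover have "side u \<noteq> side w" using u assms side_c by (simp add: even_mod_4_iff)
  ultimately show ?thesis using arc_iff assms by blast
qed

text \<open>A vertex that survives in all \<open>T i\<close> would lie in a proper out-closed set.\<close>

lemma T_eventually_leaves:
  assumes indec: indecomposable
    and w0: "w0 \<in> H" "\<And>u. u \<in> H \<Longrightarrow> c w0 = (c u + 1) mod 4 \<Longrightarrow> \<not> arc u w0"
    and v: "v \<in> H"
  shows "\<exists>k. v \<notin> T (c v + 4 * k)"
proof -
  define X where "X = {v \<in> H. \<forall>k. v \<in> T (c v + 4 * k)}"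
  have X_T: "v \<in> T i" if "v \<in> X" "i mod 4 = c v" for v i
  proof -
    have "i = c v + 4 * (i div 4)" using that(2) by presburger
    then show ?thesis using that(1) unfolding X_def by (metis (no_types, lifting) mem_Collect_eq)
  qed
  have "out_closed X"
    unfolding out_closed_def
  proof (intro conjI ballI impI)
    fix v w assume v: "v \<in> X" and w: "w \<in> H" and vw: "arc v w"
    have vH: "v \<in> H" using v by (simp add: X_def)
    have "side v \<noteq> side w" using arc_side vH w vw by blast
    then have "odd (c v + c w)" using side_c[OF vH] side_c[OF w] by simp
    moreover have "c v < 4" "c w < 4" using c_less vH w by auto
    ultimately have "c w = (c v + 1) mod 4 \<or> c v = (c w + 1) mod 4"
      using odd_add_mod_4_cases[of "c v" "c w"] by simp
    then consider "c w = (c v + 1) mod 4" | "c v = (c w + 1) mod 4" by blast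
    then have "w \<in> T (c w + 4 * k)" for k
    proof cases
      case 1
      \<comment> \<open>The index just before \<open>c w + 4 * k + 4\<close>; it is at least 3, so
        \<open>T_Suc\<close> applies, and its residue is the colour of \<open>v\<close>.\<close>
      define i where "i = c w + 4 * k + 3"
      have "i mod 4 = c v" using 1 \<open>c v < 4\<close> unfolding i_def by (auto dest!: less_4_cases)
      then have "v \<in> T i" using X_T v by blast
      moreover have "c w = Suc i mod 4" using \<open>c w < 4\<close> unfolding i_def by (auto dest!: less_4_cases)
      ultimately have "w \<in> T (Suc i)" using w vw T_Suc[of i] unfolding i_def by auto
      moreover have "Suc i = c w + 4 * k + 4" unfolding i_def by simp
      ultimately show ?thesis using T_add4 by (metis subsetD)
    next
      case 2
      have "Suc (c w + 4 * k) mod 4 = c v" using 2 by simp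
      then have "v \<in> T (Suc (c w + 4 * k))" using X_T v by blast
      moreover have "c w = (c w + 4 * k) mod 4" using \<open>c w < 4\<close> by simp
      moreover have "\<not> arc w v" using arc_iff vH w vw \<open>side v \<noteq> side w\<close> by blast
      ultimately show ?thesis using arc_outside_inside w by blast
    qed
    then show "w \<in> X" using w by (simp add: X_def)
  qed (simp add: X_def)
  then have "X = {} \<or> X = H" using indec unfolding indecomposable_def by blast
  \<comment> \<open>Without an in-neighbour in the previous chain, \<open>w0\<close> drops out when
    the spiral first returns to its chain.\<close>
  moreover have "X \<noteq> H"
  proof
    assume "X = H"
    then have "w0 \<in> T (c w0 + 4)"
      using X_T[of w0 "c w0 + 4"] w0(1) c_less[of w0] by simp
    then have "w0 \<in> T (Suc (c w0 + 3))" by (simp add: eval_nat_numeral)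
    then obtain u where "u \<in> T (c w0 + 3)" "arc u w0" using T_Suc[of "c w0 + 3"] by auto
    moreover from this have "u \<in> H" "c u = (c w0 + 3) mod 4" using T_subset by blast+
    moreover from this have "c w0 = (c u + 1) mod 4" using c_less[OF w0(1)] by (auto dest!: less_4_cases)
    ultimately show False using w0(2) by blast
  qed
  ultimately show ?thesis using v unfolding X_def by blast
qed

end

text \<open>In a layering only consecutive layers interact non-trivially, and each layer is a chain.\<close>

locale layered_tournament = bipartite_tournament +
  fixes q :: "'a \<Rightarrow> nat"
  assumes side_q: "u \<in> H \<Longrightarrow> w \<in> H \<Longrightarrow> side u \<noteq> side w \<longleftrightarrow> odd (q u + q w)"
    and arc_far: "u \<in> H \<Longrightarrow> w \<in> H \<Longrightarrow> side u \<noteq> side w \<Longrightarrow> q u + 3 \<le> q w \<Longrightarrow> arc u w"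
    and layer_chain: "u \<in> H \<Longrightarrow> w \<in> H \<Longrightarrow> q u = q w \<Longrightarrow> out u \<subseteq> out w \<or> out w \<subseteq> out u"

section \<open>From spirals to layerings\<close>

context spiral
begin

text \<open>Let \<open>q v\<close> be the last index of the residue class of \<open>c v\<close> with
  \<open>v\<close> still in the cut. Since the cuts of one chain decrease, a vertex \<open>w\<close>
  in a much later layer is still inside when \<open>u\<close> has left, and arcs lead from outside
  to inside.\<close>

lemma layering_exists:
  assumes indec: indecomposable
    and w0: "w0 \<in> H" "\<And>u. u \<in> H \<Longrightarrow> c w0 = (c u + 1) mod 4 \<Longrightarrow> \<not> arc u w0"
  shows "\<exists>q. layered_tournament H side arc q"
proof -
  have "\<exists>i. i mod 4 = c v \<and> v \<in> T i \<and> v \<notin> T (i + 4)" if v: "v \<in> H" for v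
  proof -
    \<comment> \<open>With \<open>k\<close> minimal, \<open>q v\<close> is
      \<open>c v + 4 * (k - 1)\<close>; here \<open>k\<close> is positive because
      \<open>T (c v)\<close> is the whole chain.\<close>
    obtain k where k: "v \<notin> T (c v + 4 * k)" "\<And>k'. k' < k \<Longrightarrow> v \<in> T (c v + 4 * k')"
      using T_eventually_leaves[OF indec w0 v] exists_least_iff[of "\<lambda>k. v \<notin> T (c v + 4 * k)"] by blast
    have "v \<in> T (c v)" using v c_less[OF v] by (simp add: T_less)
    then have "k \<noteq> 0" using k(1) by (metis add_0_right mult_0_right)
    then obtain k' where "k = Suc k'" by (cases k) auto
    then have "v \<in> T (c v + 4 * k')" "v \<notin> T (c v + 4 * k' + 4)" using k by (auto simp: algebra_simps)
    moreover have "(c v + 4 * k') mod 4 = c v" using c_less[OF v] by simp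
    ultimately show ?thesis by blast
  qed
  then obtain q where q: "\<And>v. v \<in> H \<Longrightarrow> q v mod 4 = c v"
    and q_in: "\<And>v. v \<in> H \<Longrightarrow> v \<in> T (q v)" and q_notin: "\<And>v. v \<in> H \<Longrightarrow> v \<notin> T (q v + 4)"
    by metis
  have "layered_tournament H side arc q"
  proof
    fix u w assume u: "u \<in> H" and w: "w \<in> H"
    show side_q: "side u \<noteq> side w \<longleftrightarrow> odd (q u + q w)"
      using side_c[OF u] side_c[OF w] q[OF u] q[OF w] by presburger
    show "out u \<subseteq> out w \<or> out w \<subseteq> out u" if "q u = q w"
      using chain[OF u w] q[OF u] q[OF w] that by simp
    show "arc u w" if sd: "side u \<noteq> side w" and far: "q u + 3 \<le> q w"
    proof -
      have "odd (q u + q w)" using sd side_q by blast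
      then consider "q w mod 4 = (q u + 5) mod 4" "q u + 5 \<le> q w" | "q w mod 4 = (q u + 3) mod 4"
        using odd_add_mod_4_far far by blast
      then show ?thesis
      proof cases
        case 1
        \<comment> \<open>In both cases \<open>u\<close> has left \<open>T (q u + 4)\<close>;
          \<open>w\<close> is compared one cut later here and one cut earlier in the other
          case.\<close>
        then have "w \<in> T (q u + 5)" using T_antimono[of "q u + 5" "q w"] 1 q_in[OF w] by blast
        then have "w \<in> T (Suc (q u + 4))" by (simp add: eval_nat_numeral)
        then show ?thesis
          using arc_outside_inside[of u "q u + 4" w] u q[OF u] q_notin[OF u] by simp
      next
        case 2
        have "w \<in> T (q u + 3)" using T_antimono[of "q u + 3" "q w"] 2 far q_in[OF w] by blast
        moreover have "u \<notin> T (Suc (q u + 3))" using q_notin[OF u] by (simp add: eval_nat_numeral)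
        moreover have "c u = Suc (q u + 3) mod 4" using q[OF u] by simp
        ultimately show ?thesis using arc_outside_inside'[of w "q u + 3" u] u by blast
      qed
    qed
  qed
  then show ?thesis by blast
qed

lemma chain_top:
  assumes "v \<in> H"
  obtains u where "u \<in> H" "c u = c v" "\<And>u'. u' \<in> H \<Longrightarrow> c u' = c v \<Longrightarrow> out u' \<subseteq> out u"
proof -
  let ?C = "{u \<in> H. c u = c v}"
  have fin: "finite (out ` ?C)" and ne: "out ` ?C \<noteq> {}" using finite_H assms by auto
  obtain m where m: "m \<in> out ` ?C" "\<forall>b\<in>out ` ?C. m \<subseteq> b \<longrightarrow> m = b"
    using finite_has_maximal[OF fin ne] ..
  obtain u where u: "u \<in> H" "c u = c v" "m = out u" using m(1) by blast
  have "out u' \<subseteq> out u" if "u' \<in> H" "c u' = c v" for u'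
  proof -
    have "out u' \<in> out ` ?C" using that by blast
    then show ?thesis using chain[of u' u] m(2) that u by auto
  qed
  then show thesis using u that by blast
qed

text \<open>If the spirals in both directions got stuck, then the top vertices of two consecutive chains
  would dominate each other.\<close>

lemma not_both_stuck:
  assumes "H \<noteq> {}"
    and fwd: "\<And>w. w \<in> H \<Longrightarrow> \<exists>u\<in>H. c w = (c u + 1) mod 4 \<and> arc u w"
    and bwd: "\<And>w. w \<in> H \<Longrightarrow> \<exists>u\<in>H. c u = (c w + 1) mod 4 \<and> arc u w"
  shows False
proof -
  obtain w where w: "w \<in> H" using assms by blast
  then obtain u where u: "u \<in> H" "c w = (c u + 1) mod 4" using fwd by blast
  obtain w1 where w1: "w1 \<in> H" "c w1 = c w" "\<And>w'. w' \<in> H \<Longrightarrow> c w' = c w \<Longrightarrow> out w' \<subseteq> out w1"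
    using chain_top[OF w] by blast
  obtain u1 where u1: "u1 \<in> H" "c u1 = c u" "\<And>u'. u' \<in> H \<Longrightarrow> c u' = c u \<Longrightarrow> out u' \<subseteq> out u1"
    using chain_top[OF u(1)] by blast
  obtain u' where u': "u' \<in> H" "c w1 = (c u' + 1) mod 4" "arc u' w1" using fwd w1 by blast
  have "(c u' + 1) mod 4 = (c u + 1) mod 4" using u' w1 u by simp
  then have "c u' = c u" using c_less[OF u'(1)] c_less[OF u(1)] by (auto dest!: less_4_cases)
  then have "arc u1 w1" using u1(3)[of u'] u' w1(1) by (auto simp: out_def)
  obtain w' where w': "w' \<in> H" "c w' = (c u1 + 1) mod 4" "arc w' u1" using bwd u1 by blast
  then have "arc w1 u1" using w1(3)[of w'] u1 u by (auto simp: out_def)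
  then show False using arc_iff[of u1 w1] arc_side[of u1 w1] \<open>arc u1 w1\<close> u1 w1 by blast
qed

text \<open>The spiral needs a vertex without an in-neighbour in the previous chain. If there is
  none, \<open>not_both_stuck\<close> yields one without an in-neighbour in the next chain, and the
  chains are numbered backwards.\<close>

lemma indecomposable_layering:
  assumes "H \<noteq> {}" and indec: indecomposable
  shows "\<exists>q. layered_tournament H side arc q"
proof (cases "\<exists>w\<in>H. \<forall>u\<in>H. c w = (c u + 1) mod 4 \<longrightarrow> \<not> arc u w")
  case True
  then show ?thesis using layering_exists[OF indec] by blast
next
  case False
  then obtain w where w: "w \<in> H" "\<And>u. u \<in> H \<Longrightarrow> c u = (c w + 1) mod 4 \<Longrightarrow> \<not> arc u w"
    using not_both_stuck[OF \<open>H \<noteq> {}\<close>] by blast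
  \<comment> \<open>Negation modulo 4 reverses the cyclic order but keeps parities, hence
    sides.\<close>
  let ?c = "\<lambda>v. (4 - c v) mod 4"
  have inj: "c u = c v" if "u \<in> H" "v \<in> H" "?c u = ?c v" for u v
    using that c_less[of u] c_less[of v] by (auto dest!: less_4_cases)
  interpret rev: spiral H side arc ?c
  proof
    fix v assume "v \<in> H"
    then show "side v \<longleftrightarrow> even (?c v)" using side_c[of v] c_less[of v] by (auto dest!: less_4_cases)
  qed (use chain inj in auto)
  have "c u = (c w + 1) mod 4" if "u \<in> H" "?c w = (?c u + 1) mod 4" for u
    using that w(1) c_less[of u] c_less[of w] by (auto dest!: less_4_cases)
  then show ?thesis using rev.layering_exists[OF indec w(1)] w(2) by blast
qed

end

section \<open>Arcs and paths across layers\<close>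

context layered_tournament
begin

text \<open>Otherwise parity would put \<open>u\<close> at least three layers above
  \<open>w\<close>, where \<open>arc_far\<close> gives the opposite arc.\<close>

lemma arc_q_le:
  assumes "u \<in> H" "w \<in> H" "arc u w"
  shows "q u \<le> q w + 1"
proof (rule ccontr)
  assume "\<not> q u \<le> q w + 1"
  moreover have "odd (q w + q u)" using side_q arc_side assms by (metis add.commute)
  ultimately have "q w + 3 \<le> q u" by presburger
  then show False using arc_far[of w u] arc_side arc_iff assms by blast
qed

lemma path_q_le:
  assumes "\<And>i. i < m \<Longrightarrow> f i \<in> H \<and> f (Suc i) \<in> H \<and> arc (f i) (f (Suc i))"
  shows "q (f 0) \<le> q (f m) + m"
  using assms
proof (induction m)
  case (Suc m)
  have "q (f 0) \<le> q (f m) + m" by (rule Suc.IH) (use Suc.prems in simp)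
  then show ?case using arc_q_le[of "f m" "f (Suc m)"] Suc.prems[of m] by simp
qed simp

end

text \<open>Put \<open>w\<close> directly before the first entry \<open>x\<close> that must not
  precede it. A conflict with some \<open>y\<close> from there on yields \<open>x \<noteq> y\<close>
  and \<open>\<not> R x y\<close>, against sortedness.\<close>

lemma sorted_wrt_insert:
  assumes "sorted_wrt R xs"
    and "\<And>x y. x \<in> set xs \<Longrightarrow> y \<in> set xs \<Longrightarrow> \<not> R x w \<Longrightarrow> \<not> R w y \<Longrightarrow> \<not> R x y \<and> x \<noteq> y"
  shows "\<exists>us vs. xs = us @ vs \<and> sorted_wrt R (us @ w # vs)"
proof -
  define us where "us = takeWhile (\<lambda>x. R x w) xs"
  define vs where "vs = dropWhile (\<lambda>x. R x w) xs"
  have xs: "xs = us @ vs" by (simp add: us_def vs_def)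
  have us: "R x w" if "x \<in> set us" for x using that set_takeWhileD unfolding us_def by metis
  have vs: "R w y" if y: "y \<in> set vs" for y
  proof (rule ccontr)
    assume wy: "\<not> R w y"
    obtain x vs' where vs': "vs = x # vs'" using y by (cases vs) auto
    then have "\<not> R x w" using hd_dropWhile[of "\<lambda>x. R x w" xs] unfolding vs_def by auto
    then have "\<not> R x y" "x \<noteq> y" using assms(2)[of x y] wy y xs vs' by auto
    then show False using assms(1) y unfolding xs vs' by (auto simp: sorted_wrt_append)
  qed
  have "sorted_wrt R (us @ w # vs)"
    using assms(1) us vs unfolding xs by (auto simp: sorted_wrt_append)
  then show ?thesis using xs by blast
qed

section \<open>A linear order compatible with all layers\<close>

context layered_tournament
begin

text \<open>\<open>before x y\<close>: the position of \<open>x\<close> below \<open>y\<close> is forced, either by the order of a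
  layer or by an arc between consecutive layers.\<close>

definition before :: "'a \<Rightarrow> 'a \<Rightarrow> bool" where
  "before x y \<longleftrightarrow> (if q x = q y then out x \<subset> out y else (q x = q y + 1 \<or> q y = q x + 1) \<and> arc y x)"

text \<open>The condition needed to insert \<open>w\<close>. With \<open>w\<close> in the highest of
  the three layers, \<open>x\<close> and \<open>y\<close> are each in that layer or just below it. A
  middle \<open>w\<close> could leave them two layers apart, where \<open>before\<close> never
  holds.\<close>

lemma before_trans_top:
  assumes H: "x \<in> H" "y \<in> H" "w \<in> H" and le: "q x \<le> q w" "q y \<le> q w"
    and "before w x" "before y w"
  shows "before y x"
proof -
  have sd: "side u \<noteq> side v" if "u \<in> H" "v \<in> H" "q u = q v + 1 \<or> q v = q u + 1" for u v
    using side_q that by auto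
  consider "q x = q w" "q y = q w" | "q x = q w" "q w = q y + 1"
    | "q w = q x + 1" "q y = q w" | "q w = q x + 1" "q w = q y + 1"
    using assms unfolding before_def by (auto split: if_splits)
  then show ?thesis
  proof cases
    case 1
    then show ?thesis using assms unfolding before_def by auto
  next
    case 2
    then have "arc w y" "out w \<subset> out x" using assms unfolding before_def by auto
    then have "arc x y" using H unfolding out_def by blast
    then show ?thesis using 2 unfolding before_def by simp
  next
    case 3
    then have a: "arc x w" "out y \<subset> out w" using assms unfolding before_def by auto
    then have "\<not> arc w x" using arc_iff arc_side H by blast
    then have "\<not> arc y x" using a H unfolding out_def by blast
    then have "arc x y" using arc_iff[of x y] sd[of x y] H 3 by simp
    then show ?thesis using 3 unfolding before_def by simp
  next
    case 4
    then have a: "arc x w" "arc w y" using assms unfolding before_def by auto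
    then have "\<not> arc y w" using arc_iff arc_side H by blast
    then have "w \<in> out x" "w \<notin> out y" using a H unfolding out_def by auto
    moreover have "q x = q y" using 4 by simp
    ultimately show ?thesis using layer_chain[of x y] H unfolding before_def by auto
  qed
qed

lemma before_asym: "x \<in> H \<Longrightarrow> y \<in> H \<Longrightarrow> before x y \<Longrightarrow> \<not> before y x"
  using arc_iff arc_side unfolding before_def by (metis less_not_sym)

text \<open>Induction that takes out a vertex of the highest layer; by
  \<open>before_trans_top\<close> it can be inserted again without conflicting demands.\<close>

lemma topological_list:
  "\<exists>xs. distinct xs \<and> set xs = H \<and> sorted_wrt (\<lambda>x y. \<not> before y x) xs"
proof -
  have "\<exists>xs. distinct xs \<and> set xs = S \<and> sorted_wrt (\<lambda>x y. \<not> before y x) xs" if "S \<subseteq> H" for S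
    using finite_subset[OF that finite_H] that
  proof (induction rule: finite_remove_induct)
    case empty
    then show ?case by simp
  next
    case (remove S)
    have fin: "finite (q ` S)" and "q ` S \<noteq> {}" using remove by auto
    then have "Max (q ` S) \<in> q ` S" by (rule Max_in)
    then obtain w where w: "w \<in> S" "q w = Max (q ` S)" by auto
    have w_max: "q v \<le> q w" if "v \<in> S" for v using Max_ge[OF fin] that w(2) by simp
    obtain xs where xs: "distinct xs" "set xs = S - {w}" "sorted_wrt (\<lambda>x y. \<not> before y x) xs"
      using remove w by blast
    have "before y x \<and> x \<noteq> y" if "x \<in> set xs" "y \<in> set xs" "before w x" "before y w" for x y
    proof -
      have "x \<in> H" "y \<in> H" "w \<in> H" "q x \<le> q w" "q y \<le> q w" using that xs w(1) w_max remove.prems by auto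
      then show ?thesis using before_trans_top[of x y w] before_asym[of y w] that by blast
    qed
    then obtain us vs where uv: "xs = us @ vs" "sorted_wrt (\<lambda>x y. \<not> before y x) (us @ w # vs)"
      using sorted_wrt_insert[OF xs(3), of w] by auto
    then have "distinct (us @ w # vs)" "set (us @ w # vs) = S" using xs w by auto
    then show ?case using uv by blast
  qed
  then show ?thesis by blast
qed

end

section \<open>Zigzags and the number of layers\<close>

text \<open>A zigzag of length \<open>2 * k + 1\<close> contains \<open>S\<^sub>k\<close>, with its indices reversed: starting at a vertex
  of \<open>A\<close>, position \<open>2 * (k - i)\<close> is \<open>x\<^sub>i\<close> and position \<open>2 * (k - i) + 1\<close> is \<open>y\<^sub>i\<close>.\<close>

definition zigzag :: "'v set \<Rightarrow> ('v \<Rightarrow> bool) \<Rightarrow> ('v \<Rightarrow> 'v \<Rightarrow> bool) \<Rightarrow> nat \<Rightarrow> (nat \<Rightarrow> 'v) \<Rightarrow> bool" where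
  "zigzag H side arc n f \<longleftrightarrow> inj_on f {..<n} \<and> f ` {..<n} \<subseteq> H \<and>
     (\<forall>i<n. \<forall>j<n. side (f i) \<noteq> side (f j) \<longleftrightarrow> odd (i + j)) \<and>
     (\<forall>i<n. \<forall>j<n. i < j \<longrightarrow> odd (i + j) \<longrightarrow> (arc (f i) (f j) \<longleftrightarrow> j = Suc i))"

context bipartite_tournament
begin

lemma shortest_path_zigzag:
  assumes f: "\<And>i. i < m \<Longrightarrow> f i \<in> H \<and> f (Suc i) \<in> H \<and> arc (f i) (f (Suc i))"
    and nonarc: "\<And>i j. i + 2 \<le> j \<Longrightarrow> j \<le> m \<Longrightarrow> \<not> arc (f i) (f j)"
    and inj: "inj_on f {..m}" and "n \<le> m"
  shows "zigzag H side arc n f"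
proof -
  define s where "s = side (f 0)"
  have side_f: "side (f i) \<longleftrightarrow> (even i \<longleftrightarrow> s)" if "i \<le> m" for i
    using that
  proof (induction i)
    case (Suc i)
    then show ?case using f[of i] arc_side[of "f i" "f (Suc i)"] by auto
  qed (simp add: s_def)
  have "side (f i) \<noteq> side (f j) \<longleftrightarrow> odd (i + j)" if "i < n" "j < n" for i j
    using side_f[of i] side_f[of j] that \<open>n \<le> m\<close> by auto
  moreover have "arc (f i) (f j) \<longleftrightarrow> j = Suc i" if "i < j" "j < n" for i j
    using f[of i] nonarc[of i j] that \<open>n \<le> m\<close> by (cases "j = Suc i") auto
  moreover have "inj_on f {..<n}" using inj by (rule inj_on_subset) (use \<open>n \<le> m\<close> in auto)
  moreover have "f ` {..<n} \<subseteq> H" using f \<open>n \<le> m\<close> by fastforce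
  ultimately show ?thesis unfolding zigzag_def by blast
qed

end

context layered_tournament
begin

text \<open>Arcs lower the layer by at most one, so long shortest paths exist if there are many layers.\<close>

lemma layers_bounded:
  assumes indec: indecomposable and no_zigzag: "\<And>f. \<not> zigzag H side arc n f" and "x \<in> H" "y \<in> H"
  shows "q x < q y + n"
proof (rule ccontr)
  assume "\<not> q x < q y + n"
  let ?E = "{(u, w). u \<in> H \<and> w \<in> H \<and> arc u w}"
  obtain f m where f: "f 0 = x" "f m = y" "\<And>i. i < m \<Longrightarrow> (f i, f (Suc i)) \<in> ?E"
    "\<And>i j. i + 2 \<le> j \<Longrightarrow> j \<le> m \<Longrightarrow> (f i, f j) \<notin> ?E" "inj_on f {..m}"
    using shortest_path[OF indecomposable_reach[OF indec \<open>x \<in> H\<close> \<open>y \<in> H\<close>]] by blast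
  have arcs: "f i \<in> H \<and> f (Suc i) \<in> H \<and> arc (f i) (f (Suc i))" if "i < m" for i
    using f(3)[OF that] by blast
  have fH: "f i \<in> H" if "i \<le> m" for i
    using that arcs[of i] f(2) \<open>y \<in> H\<close> by (cases "i = m") auto
  have "q x \<le> q y + m" using path_q_le[of m f, OF arcs] f by simp
  then have "n \<le> m" using \<open>\<not> q x < q y + n\<close> by simp
  moreover have "\<not> arc (f i) (f j)" if "i + 2 \<le> j" "j \<le> m" for i j
    using f(4)[OF that] fH[of i] fH[of j] that by simp
  ultimately have "zigzag H side arc n f" using shortest_path_zigzag[of m f n, OF arcs] f(5) by blast
  then show False using no_zigzag by blast
qed

end

section \<open>Coding by lists of lists\<close>

text \<open>A vertex is coded by its layer \<open>q\<close> and its side. All arcs between different blocks go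
  backwards; inside a block the direction of an arc is determined by the order and the layers.\<close>

definition nested_code ::
  "'v set \<Rightarrow> ('v \<Rightarrow> bool) \<Rightarrow> ('v \<Rightarrow> 'v \<Rightarrow> bool) \<Rightarrow> nat \<Rightarrow> ('v \<Rightarrow> nat) \<Rightarrow> 'v list list \<Rightarrow> bool" where
  "nested_code H side arc n q VS \<longleftrightarrow>
     distinct (concat VS) \<and> set (concat VS) = H \<and> (\<forall>v\<in>H. q v < n) \<and>
     sorted_wrt (\<lambda>xs ys. \<forall>x\<in>set xs. \<forall>y\<in>set ys. side x \<noteq> side y \<longrightarrow> arc y x) VS \<and>
     (\<forall>xs\<in>set VS. sorted_wrt (\<lambda>x y. side x \<noteq> side y \<longrightarrow> (arc y x \<longleftrightarrow> q y \<le> q x + 1)) xs)"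

text \<open>\<open>X\<close> will be an out-closed set, so all arcs across return to it and its
  blocks come first. Layers are only compared inside a block, so \<open>q1\<close> and
  \<open>q2\<close> can be combined freely.\<close>

lemma nested_code_append:
  assumes "nested_code X side arc n q1 VS1" "nested_code Y side arc n q2 VS2" "X \<inter> Y = {}"
    and arc: "\<And>x y. x \<in> X \<Longrightarrow> y \<in> Y \<Longrightarrow> side x \<noteq> side y \<Longrightarrow> arc y x"
  shows "nested_code (X \<union> Y) side arc n (\<lambda>v. if v \<in> X then q1 v else q2 v) (VS1 @ VS2)"
proof -
  let ?q = "\<lambda>v. if v \<in> X then q1 v else q2 v"
  have X: "set xs \<subseteq> X" if "xs \<in> set VS1" for xs using assms(1) that unfolding nested_code_def by auto
  have Y: "set xs \<subseteq> Y" if "xs \<in> set VS2" for xs using assms(2) that unfolding nested_code_def by auto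
  have "sorted_wrt (\<lambda>x y. side x \<noteq> side y \<longrightarrow> (arc y x \<longleftrightarrow> ?q y \<le> ?q x + 1)) xs"
    if xs: "xs \<in> set VS1 \<union> set VS2" for xs
    using xs
  proof
    assume "xs \<in> set VS1"
    then have "sorted_wrt (\<lambda>x y. side x \<noteq> side y \<longrightarrow> (arc y x \<longleftrightarrow> q1 y \<le> q1 x + 1)) xs"
      using assms(1) unfolding nested_code_def by blast
    then show ?thesis
      by (rule sorted_wrt_mono_rel[rotated]) (use X[OF \<open>xs \<in> set VS1\<close>] in auto)
  next
    assume "xs \<in> set VS2"
    then have "sorted_wrt (\<lambda>x y. side x \<noteq> side y \<longrightarrow> (arc y x \<longleftrightarrow> q2 y \<le> q2 x + 1)) xs"
      using assms(2) unfolding nested_code_def by blast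
    then show ?thesis
      by (rule sorted_wrt_mono_rel[rotated]) (use Y[OF \<open>xs \<in> set VS2\<close>] assms(3) in auto)
  qed
  moreover have "sorted_wrt (\<lambda>xs ys. \<forall>x\<in>set xs. \<forall>y\<in>set ys. side x \<noteq> side y \<longrightarrow> arc y x) (VS1 @ VS2)"
    using assms(1,2) X Y arc unfolding nested_code_def sorted_wrt_append by blast
  moreover have "distinct (concat (VS1 @ VS2))" "set (concat (VS1 @ VS2)) = X \<union> Y"
    using assms(1-3) unfolding nested_code_def by auto
  moreover have "\<forall>v\<in>X \<union> Y. ?q v < n" using assms(1,2) unfolding nested_code_def by auto
  ultimately show ?thesis unfolding nested_code_def by auto
qed

lemma spiral_subset:
  assumes "spiral H side arc c" "X \<subseteq> H"
  shows "spiral X side arc c"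
proof -
  interpret H: spiral H side arc c by fact
  interpret X: bipartite_tournament X side arc
  proof
    show "finite X" using H.finite_H \<open>X \<subseteq> H\<close> by (rule finite_subset[rotated])
    fix u w assume "u \<in> X" "w \<in> X"
    then have "u \<in> H" "w \<in> H" using \<open>X \<subseteq> H\<close> by auto
    then show "arc u w \<Longrightarrow> side u \<noteq> side w" and "side u \<noteq> side w \<Longrightarrow> arc u w \<longleftrightarrow> \<not> arc w u"
      using H.arc_side[of u w] H.arc_iff[of u w] by blast+
  qed
  have out: "X.out u = H.out u \<inter> X" for u
    using \<open>X \<subseteq> H\<close> unfolding X.out_def H.out_def by blast
  show ?thesis
  proof
    fix u w assume "u \<in> X" "w \<in> X" "c u = c w"
    then show "X.out u \<subseteq> X.out w \<or> X.out w \<subseteq> X.out u"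
      using H.chain[of u w] \<open>X \<subseteq> H\<close> unfolding out by blast
  qed (use H.c_less H.side_c \<open>X \<subseteq> H\<close> in auto)
qed

text \<open>Between consecutive layers the list order forces the arc from the later to the earlier
  vertex; layers further apart are settled by \<open>arc_far\<close>. The threshold
  \<open>q x + 1\<close> expresses both.\<close>

lemma (in layered_tournament) nested_code_single:
  assumes "\<And>v. v \<in> H \<Longrightarrow> q v < n"
  shows "\<exists>xs. nested_code H side arc n q [xs]"
proof -
  obtain xs where xs: "distinct xs" "set xs = H" "sorted_wrt (\<lambda>x y. \<not> before y x) xs"
    using topological_list by blast
  have "arc y x \<longleftrightarrow> q y \<le> q x + 1" if "x \<in> H" "y \<in> H" "\<not> before y x" "side x \<noteq> side y" for x y
  proof -
    have "odd (q x + q y)" using that side_q by blast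
    then have "q x = q y + 1 \<or> q y = q x + 1 \<or> q x + 3 \<le> q y \<or> q y + 3 \<le> q x" by presburger
    then show ?thesis
    proof (elim disjE)
      assume "q x = q y + 1"
      then show ?thesis using that arc_iff[of x y] unfolding before_def by simp
    next
      assume "q y = q x + 1"
      then show ?thesis using that arc_iff[of x y] unfolding before_def by simp
    next
      assume "q x + 3 \<le> q y"
      then show ?thesis using that arc_far[of x y] arc_iff[of x y] by simp
    next
      assume "q y + 3 \<le> q x"
      then show ?thesis using that arc_far[of y x] by simp
    qed
  qed
  then have "sorted_wrt (\<lambda>x y. side x \<noteq> side y \<longrightarrow> (arc y x \<longleftrightarrow> q y \<le> q x + 1)) xs"
    by (intro sorted_wrt_mono_rel[OF _ xs(3)]) (simp add: xs)
  then show ?thesis using xs assms unfolding nested_code_def by auto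
qed

lemma (in spiral) indecomposable_nested_code:
  assumes "H \<noteq> {}" indecomposable and no_zigzag: "\<And>f. \<not> zigzag H side arc n f"
  shows "\<exists>q VS. nested_code H side arc n q VS"
proof -
  obtain q where "layered_tournament H side arc q"
    using indecomposable_layering[OF assms(1,2)] by blast
  then interpret L: layered_tournament H side arc q .
  have fin: "finite (q ` H)" using finite_H by blast
  have "Min (q ` H) \<in> q ` H" using fin assms(1) by (intro Min_in) auto
  then obtain y where y: "y \<in> H" "q y = Min (q ` H)" by auto
  have q_ge: "q y \<le> q v" if "v \<in> H" for v using Min_le[OF fin] that y(2) by simp
  \<comment> \<open>Moving the lowest layer to 0 turns the bound on differences of layers into a
    bound on the layers.\<close>
  let ?q = "\<lambda>v. q v - q y"
  have "layered_tournament H side arc ?q"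
  proof
    fix u w assume "u \<in> H" "w \<in> H"
    then have le: "q y \<le> q u" "q y \<le> q w" using q_ge by blast+
    then have "odd (?q u + ?q w) \<longleftrightarrow> odd (q u + q w)" by (auto simp: le_iff_add)
    then show "side u \<noteq> side w \<longleftrightarrow> odd (?q u + ?q w)" using L.side_q \<open>u \<in> H\<close> \<open>w \<in> H\<close> by blast
    show "arc u w" if "side u \<noteq> side w" "?q u + 3 \<le> ?q w"
      using L.arc_far \<open>u \<in> H\<close> \<open>w \<in> H\<close> that le by simp
    show "out u \<subseteq> out w \<or> out w \<subseteq> out u" if "?q u = ?q w"
      using L.layer_chain \<open>u \<in> H\<close> \<open>w \<in> H\<close> that le by simp
  qed
  then interpret S: layered_tournament H side arc ?q .
  have "?q v < n" if "v \<in> H" for v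
    using L.layers_bounded[OF assms(2) no_zigzag that y(1)] q_ge[OF that] by simp
  then show ?thesis using S.nested_code_single by blast
qed

text \<open>Split along proper non-empty out-closed sets as long as possible; a zigzag in a part is
  one in the whole. Indecomposable pieces become single blocks.\<close>

lemma nested_code_exists:
  assumes "spiral H side arc c" and "\<And>f. \<not> zigzag H side arc n f"
  shows "\<exists>q VS. nested_code H side arc n q VS"
proof -
  have "finite H"
    using assms(1) by (simp add: spiral_def bipartite_tournament_def)
  then show ?thesis using assms
  proof (induction H rule: finite_psubset_induct)
    case (psubset H)
    interpret spiral H side arc c by (rule psubset.prems)
    consider "H = {}" | "H \<noteq> {}" indecomposable | X where "out_closed X" "X \<noteq> {}" "X \<noteq> H"
      unfolding indecomposable_def by blast
    then show ?case
    proof cases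
      case 1
      then have "nested_code H side arc n (\<lambda>_. 0) []" by (simp add: nested_code_def)
      then show ?thesis by blast
    next
      case 2
      then show ?thesis using indecomposable_nested_code psubset.prems(2) by blast
    next
      case 3
      have XH: "X \<subseteq> H" and arc_out: "\<And>x y. x \<in> X \<Longrightarrow> y \<in> H \<Longrightarrow> arc x y \<Longrightarrow> y \<in> X"
        using 3 unfolding out_closed_def by blast+
      have "X \<subset> H" "H - X \<subset> H" using 3 XH by auto
      moreover have "\<not> zigzag Y side arc n f" if "Y \<subseteq> H" for Y f
        using psubset.prems(2)[of f] that unfolding zigzag_def by blast
      moreover have "spiral Y side arc c" if "Y \<subseteq> H" for Y
        by (rule spiral_subset[OF psubset.prems(1) that])
      ultimately obtain q1 VS1 q2 VS2 where
        "nested_code X side arc n q1 VS1" "nested_code (H - X) side arc n q2 VS2"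
        using psubset.IH[of X] psubset.IH[of "H - X"] XH by (meson Diff_subset)
      then have "nested_code (X \<union> (H - X)) side arc n (\<lambda>v. if v \<in> X then q1 v else q2 v) (VS1 @ VS2)"
        by (rule nested_code_append) (use XH arc_out arc_iff in blast)+
      moreover have "X \<union> (H - X) = H" using XH by blast
      ultimately show ?thesis by auto
    qed
  qed
qed

section \<open>Decoding arcs, and embeddings of codes\<close>

lemma nth_concat_unique:
  assumes "distinct (concat VS)" "i < length VS" "j < length (VS ! i)"
    "i' < length VS" "j' < length (VS ! i')" "VS ! i ! j = VS ! i' ! j'"
  shows "i = i' \<and> j = j'"
proof -
  have "i = i'"
  proof (rule ccontr)
    assume "i \<noteq> i'"
    have "VS ! i ! j \<in> set (VS ! i) \<inter> set (VS ! i')"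
      using assms by (metis IntI nth_mem)
    then have "set (VS ! i) \<inter> set (VS ! i') \<noteq> {}" by blast
    moreover have "set (VS ! a) \<inter> set (VS ! b) = {}" if "a < b" "b < length VS" for a b
    proof -
      have "VS = take b VS @ VS ! b # drop (Suc b) VS" using that by (simp add: id_take_nth_drop)
      then have "distinct (concat (take b VS @ VS ! b # drop (Suc b) VS))" using assms(1) by simp
      then have "set (concat (take b VS)) \<inter> set (VS ! b) = {}" by auto
      moreover have "VS ! a \<in> set (take b VS)" using that by (auto simp: in_set_conv_nth)
      ultimately show ?thesis by auto
    qed
    ultimately show False using assms \<open>i \<noteq> i'\<close> by (metis Int_commute linorder_neqE_nat)
  qed
  moreover have "distinct (VS ! i)" using assms(1,2) by (simp add: distinct_concat_iff)
  ultimately show ?thesis using assms by (simp add: nth_eq_iff_index_eq)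
qed

text \<open>The data on the right all survive a list embedding. For \<open>j < j'\<close> the code
  describes the arc from \<open>w\<close> to \<open>u\<close>, whence the negation.\<close>

lemma (in bipartite_tournament) arc_nested_code:
  assumes code: "nested_code H side arc n q VS"
    and pos: "i < length VS" "j < length (VS ! i)" "i' < length VS" "j' < length (VS ! i')"
    and u: "u = VS ! i ! j" and w: "w = VS ! i' ! j'" and sides: "side u \<noteq> side w"
  shows "arc u w \<longleftrightarrow> i' < i \<or> i = i' \<and> (if j' < j then q u \<le> q w + 1 else \<not> q w \<le> q u + 1)"
proof -
  have in_block: "u \<in> set (VS ! i)" "w \<in> set (VS ! i')" "VS ! i \<in> set VS" "VS ! i' \<in> set VS"
    using pos u w by auto
  then have H: "u \<in> H" "w \<in> H" using code unfolding nested_code_def by auto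
  have blocks: "sorted_wrt (\<lambda>xs ys. \<forall>x\<in>set xs. \<forall>y\<in>set ys. side x \<noteq> side y \<longrightarrow> arc y x) VS"
    and block: "sorted_wrt (\<lambda>x y. side x \<noteq> side y \<longrightarrow> (arc y x \<longleftrightarrow> q y \<le> q x + 1)) (VS ! i)"
    using code in_block unfolding nested_code_def by blast+
  note less_block = sorted_wrt_nth_less[OF blocks]
  note less_in = sorted_wrt_nth_less[OF block]
  consider "i' < i" | "i < i'" | "i = i'" "j' < j" | "i = i'" "j < j'" | "i = i'" "j = j'"
    by linarith
  then show ?thesis
  proof cases
    case 1
    then have "arc u w" using less_block[of i' i] pos in_block sides by metis
    then show ?thesis using 1 by simp
  next
    case 2
    then have "arc w u" using less_block[of i i'] pos in_block sides by metis
    then have "\<not> arc u w" using arc_iff[OF H sides] by simp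
    then show ?thesis using 2 by simp
  next
    case 3
    then have "arc u w \<longleftrightarrow> q u \<le> q w + 1" using less_in[of j' j] pos u w sides by auto
    then show ?thesis using 3 by simp
  next
    case 4
    then have "arc w u \<longleftrightarrow> q w \<le> q u + 1" using less_in[of j j'] pos u w sides by auto
    then show ?thesis using 4 arc_iff[OF H sides] by simp
  next
    case 5
    then show ?thesis using u w sides by simp
  qed
qed

text \<open>The outer embedding moves blocks by \<open>f\<close>, the inner ones move positions by
  \<open>g i\<close>, both strictly increasing. Letters keep layer and side, so decoding gives the
  same arcs in both tournaments.\<close>

lemma nested_code_embedding:
  fixes l :: "'a \<Rightarrow> 'w" and l' :: "'b \<Rightarrow> 'w"
  assumes tour: "bipartite_tournament H side arc" "bipartite_tournament H' side' arc'"
    and code: "nested_code H side arc n q VS" "nested_code H' side' arc' n' q' VS'"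
    and emb: "list_emb (list_emb (\<lambda>a b. fst a = fst b \<and> le (snd a) (snd b)))
      (map (map (\<lambda>v. ((q v, side v), l v))) VS) (map (map (\<lambda>v. ((q' v, side' v), l' v))) VS')"
  shows "\<exists>\<phi>. inj_on \<phi> H \<and> \<phi> ` H \<subseteq> H' \<and> (\<forall>v\<in>H. side' (\<phi> v) = side v \<and> le (l v) (l' (\<phi> v))) \<and>
    (\<forall>u\<in>H. \<forall>w\<in>H. arc u w \<longleftrightarrow> arc' (\<phi> u) (\<phi> w))"
proof -
  interpret G: bipartite_tournament H side arc by fact
  interpret G': bipartite_tournament H' side' arc' by fact
  let ?R = "\<lambda>a b. fst a = fst b \<and> le (snd a) (snd b)"
  let ?c = "\<lambda>v. ((q v, side v), l v)" and ?c' = "\<lambda>v. ((q' v, side' v), l' v)"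
  obtain f where f: "strict_mono_on {..<length VS} f"
    "\<And>i. i < length VS \<Longrightarrow> f i < length VS' \<and> list_emb ?R (map ?c (VS ! i)) (map ?c' (VS' ! f i))"
    using list_emb_map_strict_mono[OF emb] by blast
  have "\<exists>g. strict_mono_on {..<length (VS ! i)} g \<and>
      (\<forall>j<length (VS ! i). g j < length (VS' ! f i) \<and> ?R (?c (VS ! i ! j)) (?c' (VS' ! f i ! g j)))"
    if "i < length VS" for i
    using list_emb_map_strict_mono f(2)[OF that] by blast
  then obtain g where g: "\<And>i. i < length VS \<Longrightarrow> strict_mono_on {..<length (VS ! i)} (g i)"
    "\<And>i j. i < length VS \<Longrightarrow> j < length (VS ! i) \<Longrightarrow>
      g i j < length (VS' ! f i) \<and> ?R (?c (VS ! i ! j)) (?c' (VS' ! f i ! g i j))"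
    by metis
  have "\<exists>i j. i < length VS \<and> j < length (VS ! i) \<and> VS ! i ! j = v" if "v \<in> H" for v
  proof -
    have "v \<in> set (concat VS)" using code(1) that unfolding nested_code_def by blast
    then obtain xs where "xs \<in> set VS" "v \<in> set xs" by auto
    then show ?thesis by (metis in_set_conv_nth)
  qed
  then obtain I J where IJ: "\<And>v. v \<in> H \<Longrightarrow> I v < length VS \<and> J v < length (VS ! I v) \<and> VS ! I v ! J v = v"
    by metis
  define \<phi> where "\<phi> v = VS' ! f (I v) ! g (I v) (J v)" for v
  have pos: "f (I v) < length VS'" "g (I v) (J v) < length (VS' ! f (I v))" if "v \<in> H" for v
    using f(2) g(2) IJ[OF that] by blast+
  have lab: "q' (\<phi> v) = q v" "side' (\<phi> v) = side v" "le (l v) (l' (\<phi> v))" if "v \<in> H" for v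
    using g(2)[of "I v" "J v"] IJ[OF that] unfolding \<phi>_def by auto
  have \<phi>_H': "\<phi> v \<in> H'" if "v \<in> H" for v
  proof -
    have "VS' ! f (I v) \<in> set VS'" "\<phi> v \<in> set (VS' ! f (I v))"
      unfolding \<phi>_def using pos[OF that] by auto
    then have "\<phi> v \<in> set (concat VS')" by auto
    then show ?thesis using code(2) unfolding nested_code_def by blast
  qed
  have f_less: "f (I u) < f (I w) \<longleftrightarrow> I u < I w" and f_eq: "f (I u) = f (I w) \<longleftrightarrow> I u = I w"
    if "u \<in> H" "w \<in> H" for u w
    using strict_mono_on_less[OF f(1)] strict_mono_on_eq[OF f(1)] IJ that by auto
  have g_less: "g (I u) (J u) < g (I w) (J w) \<longleftrightarrow> J u < J w" and g_eq: "g (I u) (J u) = g (I w) (J w) \<longleftrightarrow> J u = J w"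
    if "u \<in> H" "w \<in> H" "I u = I w" for u w
    using strict_mono_on_less[OF g(1)] strict_mono_on_eq[OF g(1)] IJ[OF that(1)] IJ[OF that(2)] that(3)
    by auto
  have "inj_on \<phi> H"
  proof (rule inj_onI)
    fix u w assume H: "u \<in> H" "w \<in> H" and "\<phi> u = \<phi> w"
    moreover have "distinct (concat VS')" using code(2) unfolding nested_code_def by blast
    ultimately have "f (I u) = f (I w)" "g (I u) (J u) = g (I w) (J w)"
      using nth_concat_unique pos unfolding \<phi>_def by metis+
    then have "I u = I w" "J u = J w" using f_eq g_eq H by blast+
    then show "u = w" using IJ H by metis
  qed
  moreover have "arc u w \<longleftrightarrow> arc' (\<phi> u) (\<phi> w)" if H: "u \<in> H" "w \<in> H" for u w
  proof (cases "side u = side w")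
    case True
    then have "\<not> arc u w" using G.arc_side[OF H] by blast
    moreover have "\<not> arc' (\<phi> u) (\<phi> w)"
      using True G'.arc_side[OF \<phi>_H'[OF H(1)] \<phi>_H'[OF H(2)]] lab(2)[OF H(1)] lab(2)[OF H(2)] by blast
    ultimately show ?thesis by blast
  next
    case False
    have "arc u w \<longleftrightarrow> I w < I u \<or> I u = I w \<and> (if J w < J u then q u \<le> q w + 1 else \<not> q w \<le> q u + 1)"
      using False IJ[OF H(1)] IJ[OF H(2)] by (intro G.arc_nested_code[OF code(1)]) simp_all
    moreover have "arc' (\<phi> u) (\<phi> w) \<longleftrightarrow> f (I w) < f (I u) \<or> f (I u) = f (I w) \<and>
      (if g (I w) (J w) < g (I u) (J u) then q' (\<phi> u) \<le> q' (\<phi> w) + 1 else \<not> q' (\<phi> w) \<le> q' (\<phi> u) + 1)"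
      using False H lab by (intro G'.arc_nested_code[OF code(2)]) (simp_all add: pos \<phi>_def)
    ultimately show ?thesis
      using f_less[OF H(2,1)] f_eq[OF H] g_less[OF H(2,1)] lab(1)[OF H(1)] lab(1)[OF H(2)]
      by (cases "I u = I w") simp_all
  qed
  ultimately show ?thesis using lab \<phi>_H' by (intro exI[of _ \<phi>]) blast
qed

section \<open>Bichain graphs without long zigzags\<close>

text \<open>Edges and non-edges across the bipartition become the two directions, so sides and arcs
  determine the graph.\<close>

definition graph_arc :: "'v graph \<Rightarrow> 'v set \<Rightarrow> 'v \<Rightarrow> 'v \<Rightarrow> bool" where
  "graph_arc G A u w \<longleftrightarrow>
     u \<in> A \<and> w \<notin> A \<and> (u, w) \<in> edges G \<or> u \<notin> A \<and> w \<in> A \<and> (u, w) \<notin> edges G"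

definition bipartition :: "'v graph \<Rightarrow> 'v set \<Rightarrow> bool" where
  "bipartition G A \<longleftrightarrow> (\<forall>u w. (u, w) \<in> edges G \<longrightarrow> (u \<in> A) \<noteq> (w \<in> A))"

lemma is_graph_sym: "is_graph G \<Longrightarrow> (u, w) \<in> edges G \<longleftrightarrow> (w, u) \<in> edges G"
  unfolding is_graph_def by blast

lemma bipartite_tournament_graph_arc:
  assumes "is_graph G"
  shows "bipartite_tournament (verts G) (\<lambda>v. v \<in> A) (graph_arc G A)"
proof
  show "finite (verts G)" using assms by (simp add: is_graph_def)
  fix u w
  show "graph_arc G A u w \<Longrightarrow> (u \<in> A) \<noteq> (w \<in> A)" by (auto simp: graph_arc_def)
  assume "(u \<in> A) \<noteq> (w \<in> A)"
  then show "graph_arc G A u w \<longleftrightarrow> \<not> graph_arc G A w u"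
    using is_graph_sym[OF assms, of u w] unfolding graph_arc_def by blast
qed

text \<open>Out-neighbourhoods are neighbourhoods on \<open>A\<close> and their complements on
  \<open>B\<close>. Complements only reverse inclusions, so all four chains stay chains.\<close>

lemma bichain_spiral:
  assumes "bichain G"
  shows "\<exists>A c. bipartition G A \<and> spiral (verts G) (\<lambda>v. v \<in> A) (graph_arc G A) c"
proof -
  obtain A B A1 A2 B1 B2 where G: "is_graph G" and AB: "A \<union> B = verts G" "A \<inter> B = {}"
    and cross: "\<And>u v. (u, v) \<in> edges G \<Longrightarrow> (u \<in> A \<and> v \<in> B) \<or> (u \<in> B \<and> v \<in> A)"
    and parts: "A = A1 \<union> A2" "A1 \<inter> A2 = {}" "B = B1 \<union> B2" "B1 \<inter> B2 = {}"
    and chains: "is_chain G A1" "is_chain G A2" "is_chain G B1" "is_chain G B2"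
    using assms unfolding bichain_def by auto
  \<comment> \<open>The numbering alternates between the sides, so cyclically consecutive chains lie
    on opposite sides.\<close>
  define c where "c v = (if v \<in> A1 then 0 else if v \<in> B1 then 1 else if v \<in> A2 then 2 else 3 :: nat)" for v
  interpret bipartite_tournament "verts G" "\<lambda>v. v \<in> A" "graph_arc G A"
    by (rule bipartite_tournament_graph_arc[OF G])
  have c_eq: "c v = 0 \<longleftrightarrow> v \<in> A1" "c v = 1 \<longleftrightarrow> v \<in> B1" "c v = 2 \<longleftrightarrow> v \<in> A2" "c v = 3 \<longleftrightarrow> v \<in> B2"
    if "v \<in> verts G" for v
    using that AB parts unfolding c_def by auto
  have out_A: "out u = nbhd G u" if "u \<in> A" for u
  proof (rule set_eqI)
    fix w
    have "w \<in> verts G \<and> w \<notin> A" if "(u, w) \<in> edges G"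
      using cross[OF that] \<open>u \<in> A\<close> AB by blast
    then show "w \<in> out u \<longleftrightarrow> w \<in> nbhd G u"
      using \<open>u \<in> A\<close> by (auto simp: out_def graph_arc_def nbhd_def)
  qed
  have out_B: "out u = A - nbhd G u" if "u \<in> B" for u
  proof -
    have "u \<notin> A" "A \<subseteq> verts G" using that AB by auto
    then show ?thesis by (auto simp: out_def graph_arc_def nbhd_def)
  qed
  have "spiral (verts G) (\<lambda>v. v \<in> A) (graph_arc G A) c"
  proof
    show "c v < 4" for v by (simp add: c_def)
    show "v \<in> A \<longleftrightarrow> even (c v)" if "v \<in> verts G" for v
      using that AB parts unfolding c_def by auto
    show "out u \<subseteq> out w \<or> out w \<subseteq> out u" if V: "u \<in> verts G" "w \<in> verts G" and eq: "c u = c w" for u w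
    proof -
      have "\<exists>X\<in>{A1, A2, B1, B2}. u \<in> X \<and> w \<in> X"
        using eq c_eq[OF V(1)] c_eq[OF V(2)] V AB parts by auto
      then have "(u \<in> A \<and> w \<in> A \<or> u \<in> B \<and> w \<in> B) \<and> (nbhd G u \<subseteq> nbhd G w \<or> nbhd G w \<subseteq> nbhd G u)"
        using chains parts unfolding is_chain_def by blast
      then show ?thesis using out_A out_B by blast
    qed
  qed
  moreover have "bipartition G A" using cross AB unfolding bipartition_def by blast
  ultimately show ?thesis by blast
qed

lemma verts_Sk: "verts (Sk k) = {v. 1 \<le> v div 2 \<and> v div 2 \<le> k}"
proof -
  have "v \<in> verts (Sk k) \<longleftrightarrow> 1 \<le> v div 2 \<and> v div 2 \<le> k" for v
  proof
    assume "1 \<le> v div 2 \<and> v div 2 \<le> k"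
    moreover have "v = 2 * (v div 2) \<or> v = 2 * (v div 2) + 1" by presburger
    ultimately show "v \<in> verts (Sk k)" unfolding Sk_def verts_def by auto
  qed (auto simp: Sk_def verts_def)
  then show ?thesis by blast
qed

lemma edges_Sk_even_odd:
  "(2 * i, 2 * j + 1) \<in> edges (Sk k) \<longleftrightarrow> 1 \<le> i \<and> i \<le> k \<and> 1 \<le> j \<and> j \<le> k \<and> (j = i \<or> i + 2 \<le> j)"
  "(2 * j + 1, 2 * i) \<in> edges (Sk k) \<longleftrightarrow> 1 \<le> i \<and> i \<le> k \<and> 1 \<le> j \<and> j \<le> k \<and> (j = i \<or> i + 2 \<le> j)"
  unfolding Sk_def edges_def by (auto, presburger+)

lemmas edges_Sk_simps = edges_Sk_even_odd edges_Sk_even_odd[folded Suc_eq_plus1]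

lemma edges_Sk_parity: "(u, v) \<in> edges (Sk k) \<Longrightarrow> even u \<noteq> even v"
  unfolding Sk_def edges_def by auto

lemma is_graph_Sk: "is_graph (Sk k)"
  unfolding is_graph_def
proof (intro conjI allI impI subsetI notI)
  have "verts (Sk k) \<subseteq> {..2 * k + 1}" by (auto simp: verts_Sk)
  then show "finite (verts (Sk k))" by (rule finite_subset) simp
  show "e \<in> verts (Sk k) \<times> verts (Sk k)" if "e \<in> edges (Sk k)" for e
    using that unfolding verts_Sk by (auto simp: Sk_def edges_def)
  show "(v, u) \<in> edges (Sk k)" if "(u, v) \<in> edges (Sk k)" for u v
    using that unfolding Sk_def edges_def by auto
  show False if "(v, v) \<in> edges (Sk k)" for v
    using edges_Sk_parity that by blast
qed

text \<open>The only forward arcs of a zigzag are its steps, so a vertex in \<open>A\<close> is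
  adjacent to its successor and, on the other side, to everything at least three positions
  back.\<close>

lemma zigzag_induced_Sk:
  assumes G: "is_graph G" and bip: "bipartition G A"
    and zz: "zigzag (verts G) (\<lambda>v. v \<in> A) (graph_arc G A) (2 * k + 1) f"
  shows "induced_sub (Sk k) G"
proof -
  interpret bipartite_tournament "verts G" "\<lambda>v. v \<in> A" "graph_arc G A"
    by (rule bipartite_tournament_graph_arc[OF G])
  have inj: "inj_on f {..<2 * k + 1}" and f_in: "\<And>i. i < 2 * k + 1 \<Longrightarrow> f i \<in> verts G"
    and f_side: "\<And>i j. i < 2 * k + 1 \<Longrightarrow> j < 2 * k + 1 \<Longrightarrow> (f i \<in> A) \<noteq> (f j \<in> A) \<longleftrightarrow> odd (i + j)"
    and f_arc: "\<And>i j. i < j \<Longrightarrow> j < 2 * k + 1 \<Longrightarrow> odd (i + j) \<Longrightarrow> graph_arc G A (f i) (f j) \<longleftrightarrow> j = Suc i"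
    using zz unfolding zigzag_def by auto
  \<comment> \<open>If the zigzag starts outside \<open>A\<close>, its first vertex is skipped; the
    extra position in \<open>2 * k + 1\<close> allows for this.\<close>
  define s where "s = (if f 0 \<in> A then 0 else 1 :: nat)"
  have side: "f i \<in> A \<longleftrightarrow> even (i + s)" if "i < 2 * k + 1" for i
    using f_side[OF that, of 0] that unfolding s_def by auto
  have edge: "(f p, f r) \<in> edges G \<longleftrightarrow> r = Suc p \<or> r + 3 \<le> p"
    if "p < 2 * k + 1" "r < 2 * k + 1" "f p \<in> A" "f r \<notin> A" for p r
  proof -
    have odd: "odd (p + r)" using f_side[of p r] that by blast
    have "(f p, f r) \<in> edges G \<longleftrightarrow> graph_arc G A (f p) (f r)" using that by (simp add: graph_arc_def)
    also have "\<dots> \<longleftrightarrow> r = Suc p \<or> r + 3 \<le> p"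
    proof (cases "p < r")
      case True
      then show ?thesis using f_arc[of p r] odd that by auto
    next
      case False
      then have "r < p" using odd by (metis even_add linorder_neqE_nat)
      then have "graph_arc G A (f r) (f p) \<longleftrightarrow> p = Suc r" using f_arc[of r p] odd that by (simp add: add.commute)
      moreover have "graph_arc G A (f p) (f r) \<longleftrightarrow> \<not> graph_arc G A (f r) (f p)"
        using arc_iff[of "f p" "f r"] f_in that by blast
      moreover have "p \<noteq> Suc r \<longleftrightarrow> r + 3 \<le> p" using \<open>r < p\<close> odd by presburger
      ultimately show ?thesis using False by auto
    qed
    finally show ?thesis .
  qed
  \<comment> \<open>Indices run backwards: x_i goes to position \<open>s + 2 * (k - i)\<close> and
    y_i to the next one.\<close>
  define g where "g v = s + 2 * (k - v div 2) + v mod 2" for v :: nat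
  have g_less: "g v < 2 * k + 1" if "v \<in> verts (Sk k)" for v
  proof -
    have "k - v div 2 + 1 \<le> k" using that unfolding verts_Sk by auto
    moreover have "v mod 2 \<le> 1" "s \<le> 1" by (simp_all add: s_def)
    ultimately show ?thesis unfolding g_def by linarith
  qed
  have g_side: "f (g v) \<in> A \<longleftrightarrow> even v" if "v \<in> verts (Sk k)" for v
    using side[OF g_less[OF that]] unfolding g_def by (auto simp: even_mod_2_iff)
  have "inj_on g (verts (Sk k))"
  proof (rule inj_onI)
    fix u v assume V: "u \<in> verts (Sk k)" "v \<in> verts (Sk k)" and "g u = g v"
    then have eq: "2 * (k - u div 2) + u mod 2 = 2 * (k - v div 2) + v mod 2" by (simp add: g_def)
    have code: "(2 * m + b mod 2) div 2 = m" "(2 * m + b mod 2) mod 2 = b mod 2" for m b :: nat by simp_all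
    have "k - u div 2 = k - v div 2" "u mod 2 = v mod 2" using eq code by metis+
    moreover have "u div 2 \<le> k" "v div 2 \<le> k" using V unfolding verts_Sk by blast+
    ultimately have "u div 2 = v div 2" "u mod 2 = v mod 2" by (metis diff_diff_cancel)+
    then show "u = v" by (metis div_mult_mod_eq)
  qed
  then have "inj_on (f \<circ> g) (verts (Sk k))"
    using inj g_less by (intro comp_inj_on) (auto intro: inj_on_subset)
  moreover have "(f \<circ> g) ` verts (Sk k) \<subseteq> verts G" using f_in g_less by auto
  moreover have even_odd: "(u, v) \<in> edges (Sk k) \<longleftrightarrow> (f (g u), f (g v)) \<in> edges G"
    if V: "u \<in> verts (Sk k)" "v \<in> verts (Sk k)" and "even u" "odd v" for u v
  proof -
    obtain i where i: "u = 2 * i" using \<open>even u\<close> by (auto elim: evenE)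
    obtain j where j: "v = 2 * j + 1" using \<open>odd v\<close> by (auto elim: oddE)
    have ij: "1 \<le> i" "i \<le> k" "1 \<le> j" "j \<le> k" using V unfolding verts_Sk i j by auto
    have "(f (g u), f (g v)) \<in> edges G \<longleftrightarrow> g v = Suc (g u) \<or> g v + 3 \<le> g u"
      using edge[OF g_less[OF V(1)] g_less[OF V(2)]] g_side V that by blast
    also have "\<dots> \<longleftrightarrow> j = i \<or> i + 2 \<le> j"
      using ij unfolding g_def i j by auto
    also have "\<dots> \<longleftrightarrow> (u, v) \<in> edges (Sk k)" unfolding i j edges_Sk_even_odd using ij by blast
    finally show ?thesis by blast
  qed
  moreover have "(u, v) \<in> edges (Sk k) \<longleftrightarrow> ((f \<circ> g) u, (f \<circ> g) v) \<in> edges G"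
    if V: "u \<in> verts (Sk k)" "v \<in> verts (Sk k)" for u v
  proof (cases "even u = even v")
    case True
    then have "(u, v) \<notin> edges (Sk k)" using edges_Sk_parity by blast
    moreover have "(f (g u), f (g v)) \<notin> edges G"
      using bip g_side V True unfolding bipartition_def by blast
    ultimately show ?thesis by simp
  next
    case False
    then consider "even u" "odd v" | "even v" "odd u" by blast
    then show ?thesis
    proof cases
      case 1
      then show ?thesis using even_odd V by simp
    next
      case 2
      then have "(v, u) \<in> edges (Sk k) \<longleftrightarrow> (f (g v), f (g u)) \<in> edges G" using even_odd V by simp
      then show ?thesis
        using is_graph_sym[OF G, of "f (g u)"] is_graph_sym[OF is_graph_Sk, of u v] by simp
    qed
  qed
  ultimately show ?thesis unfolding induced_sub_def by blast
qed

text \<open>One missing \<open>Sk k\<close> excludes zigzags of length \<open>2 * k + 1\<close> from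
  the hereditary class. So all codes use boundedly many layers, and Higman's lemma, applied twice,
  embeds the code of one member of the antichain into that of another.\<close>

lemma labelled_wqo_of_no_Sk:
  fixes D :: "nat graph set" and W :: "'w set"
  assumes D: "D \<subseteq> bichain_class" "hereditary D" and no_Sk: "Sk k \<notin> D"
  shows "labelled_wqo_wrt D W le"
  unfolding labelled_wqo_wrt_def
proof (intro impI notI)
  assume wqo: "wqo_on W le" and "\<exists>\<A>. labelled_antichain D W le \<A>"
  then obtain \<A> where "labelled_antichain D W le \<A>" by blast
  then have inf: "infinite \<A>"
    and \<A>: "\<And>G l. (G, l) \<in> \<A> \<Longrightarrow> G \<in> D \<and> l ` verts G \<subseteq> W"
    and anti: "\<And>a b. a \<in> \<A> \<Longrightarrow> b \<in> \<A> \<Longrightarrow> a \<noteq> b \<Longrightarrow> \<not> lab_sub le a b"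
    unfolding labelled_antichain_def by fast+
  obtain s :: "nat \<Rightarrow> nat graph \<times> (nat \<Rightarrow> 'w)" where s: "inj s" "range s \<subseteq> \<A>"
    using infinite_countable_subset[OF inf] by blast
  define G where "G i = fst (s i)" for i
  define l where "l i = snd (s i)" for i
  have s_eq: "s i = (G i, l i)" for i by (simp add: G_def l_def)
  have GD: "G i \<in> D" and lW: "l i ` verts (G i) \<subseteq> W" for i
    using \<A>[of "G i" "l i"] s(2) s_eq[of i] by (metis rangeI subsetD)+
  have graph: "is_graph (G i)" for i
    using GD[of i] D(1) unfolding bichain_class_def bichain_def by blast
  let ?n = "2 * k + 1"
  have "\<exists>A q VS. bipartition (G i) A \<and> nested_code (verts (G i)) (\<lambda>v. v \<in> A) (graph_arc (G i) A) ?n q VS" for i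
  proof -
    have "bichain (G i)" using GD[of i] D(1) unfolding bichain_class_def by blast
    then obtain A c where A: "bipartition (G i) A"
      and c: "spiral (verts (G i)) (\<lambda>v. v \<in> A) (graph_arc (G i) A) c"
      using bichain_spiral by blast
    have "\<not> zigzag (verts (G i)) (\<lambda>v. v \<in> A) (graph_arc (G i) A) ?n f" for f
      using zigzag_induced_Sk[OF graph A] GD[of i] D(2) no_Sk is_graph_Sk
      unfolding hereditary_def by blast
    then show ?thesis using nested_code_exists[OF c] A by blast
  qed
  then obtain A q VS where A: "\<And>i. bipartition (G i) (A i)"
    and code: "\<And>i. nested_code (verts (G i)) (\<lambda>v. v \<in> A i) (graph_arc (G i) (A i)) ?n (q i) (VS i)"
    by metis
  let ?R = "\<lambda>a b. fst a = fst b \<and> le (snd a) (snd b)"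
  let ?L = "({..<?n} \<times> (UNIV :: bool set)) \<times> W"
  define code_of where "code_of i = map (map (\<lambda>v. ((q i v, v \<in> A i), l i v))) (VS i)" for i
  have "wqo_on (lists (lists ?L)) (list_emb (list_emb ?R))"
    by (intro higman wqo_on_finite_letters_Times wqo) simp
  moreover have "code_of i \<in> lists (lists ?L)" for i
  proof -
    have "((q i v, v \<in> A i), l i v) \<in> ?L" if "xs \<in> set (VS i)" "v \<in> set xs" for xs v
    proof -
      have "v \<in> set (concat (VS i))" using that by auto
      then show ?thesis using code[of i] lW[of i] unfolding nested_code_def by blast
    qed
    then show ?thesis unfolding code_of_def by auto
  qed
  ultimately obtain i j where "i < j" and emb: "list_emb (list_emb ?R) (code_of i) (code_of j)"
    unfolding wqo_on_def by meson
  obtain \<phi> where inj: "inj_on \<phi> (verts (G i))" and sub: "\<phi> ` verts (G i) \<subseteq> verts (G j)"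
    and lab: "\<And>v. v \<in> verts (G i) \<Longrightarrow> (\<phi> v \<in> A j) = (v \<in> A i) \<and> le (l i v) (l j (\<phi> v))"
    and arc: "\<And>u w. u \<in> verts (G i) \<Longrightarrow> w \<in> verts (G i) \<Longrightarrow>
      graph_arc (G i) (A i) u w \<longleftrightarrow> graph_arc (G j) (A j) (\<phi> u) (\<phi> w)"
    using nested_code_embedding[OF bipartite_tournament_graph_arc[OF graph]
        bipartite_tournament_graph_arc[OF graph] code code emb[unfolded code_of_def]] by blast
  \<comment> \<open>Sides and arcs determine the edges because neither graph has an edge inside a
    side.\<close>
  have "(u, w) \<in> edges (G i) \<longleftrightarrow> (\<phi> u, \<phi> w) \<in> edges (G j)"
    if "u \<in> verts (G i)" "w \<in> verts (G i)" for u w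
    using arc[OF that] lab[OF that(1)] lab[OF that(2)] A[of i] A[of j]
    unfolding graph_arc_def bipartition_def by blast
  then have "lab_sub le (s i) (s j)"
    unfolding lab_sub_def s_eq using inj sub lab by auto
  moreover have "s i \<noteq> s j" using s(1) \<open>i < j\<close> by (metis injD less_irrefl)
  ultimately show False using anti s(2) by blast
qed

section \<open>The antichain\<close>

text \<open>Split the x's and the y's by the parity of the index. Distinct indices of equal parity
  differ by at least 2, so neighbourhoods shrink along the x's and grow along the y's.\<close>

lemma bichain_Sk: "bichain (Sk k)"
proof -
  let ?V = "verts (Sk k)"
  let ?part = "\<lambda>p e. {v \<in> ?V. even v = p \<and> even (v div 2) = e}"
  have chain: "is_chain (Sk k) (?part p e)" for p e
  proof -
    have "nbhd (Sk k) (2 * j + 1) \<subseteq> nbhd (Sk k) (2 * i + 1)"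
      if "i \<le> k" "1 \<le> j" "even i = even j" "j \<le> i" for i j
    proof
      fix v assume v: "v \<in> nbhd (Sk k) (2 * j + 1)"
      then have "even v" using edges_Sk_parity[of "2 * j + 1" v k] unfolding nbhd_def by simp
      then obtain a where a: "v = 2 * a" by (auto elim: evenE)
      have "a = j \<or> a + 2 \<le> j" "1 \<le> a" "a \<le> k" using v unfolding nbhd_def a by (auto simp: edges_Sk_simps)
      moreover have "i = j \<or> j + 2 \<le> i" using that by presburger
      ultimately show "v \<in> nbhd (Sk k) (2 * i + 1)"
        using that unfolding nbhd_def a by (auto simp: edges_Sk_simps)
    qed
    moreover have "nbhd (Sk k) (2 * i) \<subseteq> nbhd (Sk k) (2 * j)"
      if "i \<le> k" "1 \<le> j" "even i = even j" "j \<le> i" for i j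
    proof
      fix v assume v: "v \<in> nbhd (Sk k) (2 * i)"
      then have "odd v" using edges_Sk_parity[of "2 * i" v k] unfolding nbhd_def by simp
      then obtain b where b: "v = 2 * b + 1" by (auto elim: oddE)
      have "b = i \<or> i + 2 \<le> b" "1 \<le> b" "b \<le> k" using v unfolding nbhd_def b by (auto simp: edges_Sk_simps)
      moreover have "i = j \<or> j + 2 \<le> i" using that by presburger
      ultimately show "v \<in> nbhd (Sk k) (2 * j)"
        using that unfolding nbhd_def b by (auto simp: edges_Sk_simps)
    qed
    ultimately have nested: "nbhd (Sk k) (2 * j) \<subseteq> nbhd (Sk k) (2 * i) \<or> nbhd (Sk k) (2 * i) \<subseteq> nbhd (Sk k) (2 * j)"
      "nbhd (Sk k) (2 * j + 1) \<subseteq> nbhd (Sk k) (2 * i + 1) \<or> nbhd (Sk k) (2 * i + 1) \<subseteq> nbhd (Sk k) (2 * j + 1)"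
      if "1 \<le> i" "i \<le> k" "1 \<le> j" "j \<le> k" "even i = even j" for i j
      using that nat_le_linear[of i j] by metis+
    show ?thesis
      unfolding is_chain_def
    proof (intro ballI)
      fix u v assume u: "u \<in> ?part p e" and v: "v \<in> ?part p e"
      then have range: "1 \<le> u div 2" "u div 2 \<le> k" "1 \<le> v div 2" "v div 2 \<le> k" "even (u div 2) = even (v div 2)"
        unfolding verts_Sk by auto
      have "u = 2 * (u div 2) \<and> v = 2 * (v div 2) \<or> u = 2 * (u div 2) + 1 \<and> v = 2 * (v div 2) + 1"
        using u v by auto
      then show "nbhd (Sk k) u \<subseteq> nbhd (Sk k) v \<or> nbhd (Sk k) v \<subseteq> nbhd (Sk k) u"
        using nested[OF range] by metis
    qed
  qed
  define A1 A2 B1 B2 where "A1 = ?part True True" and "A2 = ?part True False"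
    and "B1 = ?part False True" and "B2 = ?part False False"
  note defs = A1_def A2_def B1_def B2_def
  have chains: "is_chain (Sk k) A1" "is_chain (Sk k) A2" "is_chain (Sk k) B1" "is_chain (Sk k) B2"
    unfolding defs by (rule chain)+
  have "(u \<in> A1 \<union> A2 \<and> v \<in> B1 \<union> B2) \<or> (u \<in> B1 \<union> B2 \<and> v \<in> A1 \<union> A2)"
    if "(u, v) \<in> edges (Sk k)" for u v
  proof -
    have "u \<in> ?V" "v \<in> ?V" using that is_graph_Sk[of k] unfolding is_graph_def by blast+
    then show ?thesis using edges_Sk_parity[OF that] unfolding defs by blast
  qed
  then have cross: "\<forall>u v. (u, v) \<in> edges (Sk k) \<longrightarrow>
      (u \<in> A1 \<union> A2 \<and> v \<in> B1 \<union> B2) \<or> (u \<in> B1 \<union> B2 \<and> v \<in> A1 \<union> A2)" by blast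
  have parts: "(A1 \<union> A2) \<union> (B1 \<union> B2) = ?V" "(A1 \<union> A2) \<inter> (B1 \<union> B2) = {}" "A1 \<inter> A2 = {}" "B1 \<inter> B2 = {}"
    unfolding defs by blast+
  show ?thesis
    unfolding bichain_def
    by (intro conjI exI[of _ "A1 \<union> A2"] exI[of _ "B1 \<union> B2"] exI[of _ A1] exI[of _ A2]
        exI[of _ B1] exI[of _ B2] is_graph_Sk parts cross chains refl)
qed

section \<open>Embeddings between the graphs S_k\<close>

definition embedding :: "'v graph \<Rightarrow> 'u graph \<Rightarrow> ('v \<Rightarrow> 'u) \<Rightarrow> bool" where
  "embedding H G \<phi> \<longleftrightarrow> inj_on \<phi> (verts H) \<and> \<phi> ` verts H \<subseteq> verts G \<and>
     (\<forall>u\<in>verts H. \<forall>v\<in>verts H. (u, v) \<in> edges H \<longleftrightarrow> (\<phi> u, \<phi> v) \<in> edges G)"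

lemma embedding_compose:
  assumes "embedding H G \<phi>" "embedding G F \<psi>"
  shows "embedding H F (\<psi> \<circ> \<phi>)"
proof -
  have "inj_on (\<psi> \<circ> \<phi>) (verts H)"
    using assms unfolding embedding_def by (intro comp_inj_on) (auto intro: inj_on_subset)
  then show ?thesis using assms unfolding embedding_def by (auto simp: image_subset_iff)
qed

text \<open>Exchanges x_i with y_(m + 1 - i); the term \<open>1 - v mod 2\<close> switches the
  side.\<close>

definition Sk_flip :: "nat \<Rightarrow> nat \<Rightarrow> nat" where
  "Sk_flip m v = 2 * (m + 1 - v div 2) + (1 - v mod 2)"

text \<open>Adjacency of x_i and y_j depends only on \<open>j - i\<close>, which is unchanged when
  \<open>(i, j)\<close> becomes \<open>(m + 1 - j, m + 1 - i)\<close>.\<close>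

lemma embedding_Sk_flip: "embedding (Sk m) (Sk m) (Sk_flip m)"
proof -
  have flip: "Sk_flip m (2 * i) = 2 * (m + 1 - i) + 1" "Sk_flip m (2 * i + 1) = 2 * (m + 1 - i)" for i
    by (simp_all add: Sk_flip_def)
  have involution: "Sk_flip m (Sk_flip m v) = v \<and> Sk_flip m v \<in> verts (Sk m)" if "v \<in> verts (Sk m)" for v
  proof (cases "even v")
    case True
    then obtain i where "v = 2 * i" by (auto elim: evenE)
    then show ?thesis using that unfolding verts_Sk by (auto simp: Sk_flip_def)
  next
    case False
    then obtain i where "v = 2 * i + 1" by (auto elim: oddE)
    then show ?thesis using that unfolding verts_Sk by (auto simp: Sk_flip_def)
  qed
  have even_odd: "(u, v) \<in> edges (Sk m) \<longleftrightarrow> (Sk_flip m u, Sk_flip m v) \<in> edges (Sk m)"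
    if V: "u \<in> verts (Sk m)" "v \<in> verts (Sk m)" and par: "even u" "odd v" for u v
  proof -
    obtain i where i: "u = 2 * i" using par by (auto elim: evenE)
    obtain j where j: "v = 2 * j + 1" using par by (auto elim: oddE)
    show ?thesis using V unfolding i j flip edges_Sk_even_odd verts_Sk by auto
  qed
  have parity: "even (Sk_flip m v) \<longleftrightarrow> odd v" for v
    unfolding Sk_flip_def by presburger
  have "(u, v) \<in> edges (Sk m) \<longleftrightarrow> (Sk_flip m u, Sk_flip m v) \<in> edges (Sk m)"
    if V: "u \<in> verts (Sk m)" "v \<in> verts (Sk m)" for u v
  proof (cases "even u = even v")
    case True
    then show ?thesis using edges_Sk_parity parity by metis
  next
    case False
    then consider "even u" "odd v" | "even v" "odd u" by blast
    then show ?thesis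
    proof cases
      case 1
      then show ?thesis using even_odd V by blast
    next
      case 2
      then show ?thesis using even_odd[OF V(2,1)] is_graph_sym[OF is_graph_Sk] by metis
    qed
  qed
  moreover have "inj_on (Sk_flip m) (verts (Sk m))" using involution by (metis inj_onI)
  ultimately show ?thesis using involution unfolding embedding_def by blast
qed

text \<open>An embedding of \<open>S\<^sub>k\<close> that is anchored at \<open>x\<^sub>1 y\<^sub>1\<close> and at the far end is the identity: going from
  \<open>i\<close> to \<open>i + 1\<close>, the vertex \<open>y\<^sub>i\<^sub>+\<^sub>1\<close> must go to a non-neighbour of \<open>x\<^sub>i\<close> and then \<open>x\<^sub>i\<^sub>+\<^sub>1\<close> to a neighbour
  of \<open>y\<^sub>i\<^sub>+\<^sub>1\<close>, and each time there is only one free candidate.\<close>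

lemma embedding_Sk_rigid:
  assumes emb: "embedding (Sk k) (Sk m) \<phi>" and k: "3 \<le> k" and m: "3 \<le> m"
    and start: "\<phi> 2 = 2" "\<phi> 3 = 3" and stop: "\<phi> (2 * k) = 2 * m" "\<phi> (2 * k + 1) = 2 * m + 1"
  shows "k = m"
proof (rule ccontr)
  assume "k \<noteq> m"
  have inj: "\<And>u v. u \<in> verts (Sk k) \<Longrightarrow> v \<in> verts (Sk k) \<Longrightarrow> \<phi> u = \<phi> v \<Longrightarrow> u = v"
    and sub: "\<And>v. v \<in> verts (Sk k) \<Longrightarrow> \<phi> v \<in> verts (Sk m)"
    and edge: "\<And>u v. u \<in> verts (Sk k) \<Longrightarrow> v \<in> verts (Sk k) \<Longrightarrow>
      (u, v) \<in> edges (Sk k) \<longleftrightarrow> (\<phi> u, \<phi> v) \<in> edges (Sk m)"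
    using emb unfolding embedding_def by (auto dest: inj_onD)
  have V: "2 * i \<in> verts (Sk k)" "2 * i + 1 \<in> verts (Sk k)" if "1 \<le> i" "i \<le> k" for i
    using that by (auto simp: verts_Sk)
  have adj: "(\<phi> (2 * i), \<phi> (2 * j + 1)) \<in> edges (Sk m) \<longleftrightarrow> j = i \<or> i + 2 \<le> j"
    if "1 \<le> i" "i \<le> k" "1 \<le> j" "j \<le> k" for i j
    using edge[OF V(1)[OF that(1,2)] V(2)[OF that(3,4)]] edges_Sk_even_odd(1) that by auto
  \<comment> \<open>All later y's are adjacent to the fixed x_1. The side of y_2 is found through
    x_2, which is adjacent to y_k as soon as \<open>k \<ge> 4\<close>.\<close>
  have odd_y2: "odd (\<phi> 5)"
  proof (cases "k = 3")
    case False
    then have "(\<phi> 4, \<phi> (2 * k + 1)) \<in> edges (Sk m)" using adj[of 2 k] k by simp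
    then have "even (\<phi> 4)" using edges_Sk_parity stop(2) by fastforce
    moreover have "(\<phi> 4, \<phi> 5) \<in> edges (Sk m)" using adj[of 2 2] k by simp
    ultimately show ?thesis using edges_Sk_parity by blast
  next
    case True
    show ?thesis
    proof (rule ccontr)
      \<comment> \<open>If x_2 and y_2 switched sides, their images would be non-neighbours of x_1
        and y_m respectively; only index 2 is left for both, and \<open>m = 3\<close>
        follows.\<close>
      assume "\<not> odd (\<phi> 5)"
      then obtain b where b: "\<phi> 5 = 2 * b" by (auto elim: evenE)
      have "(\<phi> 4, \<phi> 5) \<in> edges (Sk m)" using adj[of 2 2] k by simp
      then have ba: "(\<phi> 5, \<phi> 4) \<in> edges (Sk m)" using is_graph_sym[OF is_graph_Sk] by blast
      then have "odd (\<phi> 4)" using edges_Sk_parity b by fastforce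
      then obtain a where a: "\<phi> 4 = 2 * a + 1" by (auto elim: oddE)
      have rng: "1 \<le> a" "a \<le> m" "1 \<le> b" "b \<le> m" "a = b \<or> b + 2 \<le> a"
        using ba unfolding a b edges_Sk_even_odd by blast+
      have "(2, 4) \<notin> edges (Sk k)" "(5, 7) \<notin> edges (Sk k)"
        using edges_Sk_parity[of 2 4 k] edges_Sk_parity[of 5 7 k] by auto
      then have "(2, \<phi> 4) \<notin> edges (Sk m)" "(\<phi> 5, \<phi> 7) \<notin> edges (Sk m)"
        using edge[of 2 4] edge[of 5 7] V[of 1] V[of 2] V[of 3] k start by simp_all
      then have non: "(2 * 1, 2 * a + 1) \<notin> edges (Sk m)" "(2 * b, 2 * m + 1) \<notin> edges (Sk m)"
        using stop(2) True unfolding a b by simp_all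
      then have "a = 2" "b = 2" using rng unfolding edges_Sk_even_odd by auto
      then have "m = 3" using non(2) m unfolding edges_Sk_even_odd by auto
      then show False using True \<open>k \<noteq> m\<close> by simp
    qed
  qed
  have odd_y: "odd (\<phi> (2 * i + 1))" if "2 \<le> i" "i \<le> k" for i
  proof (cases "i = 2")
    case True
    then show ?thesis using odd_y2 by simp
  next
    case False
    then have "(\<phi> 2, \<phi> (2 * i + 1)) \<in> edges (Sk m)" using adj[of 1 i] that by simp
    then show ?thesis using edges_Sk_parity start(1) by fastforce
  qed
  have fixed: "\<phi> (2 * i) = 2 * i \<and> \<phi> (2 * i + 1) = 2 * i + 1" if "1 \<le> i" "i \<le> k" for i
    using that
  proof (induction i rule: less_induct)
    case (less n)
    show ?case
    proof (cases "n = 1")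
      case True
      then show ?thesis using start by simp
    next
      case False
      then obtain i where n: "n = Suc i" and i: "1 \<le> i" using less.prems by (cases n) auto
      have IH: "\<phi> (2 * j) = 2 * j" "\<phi> (2 * j + 1) = 2 * j + 1" if "1 \<le> j" "j \<le> i" for j
        using less.IH[of j] less.prems that n by auto
      obtain b where b: "\<phi> (2 * n + 1) = 2 * b + 1" using odd_y[of n] less.prems n i by (auto elim: oddE)
      have b_rng: "1 \<le> b" "b \<le> m" using sub[OF V(2)[OF less.prems]] unfolding b verts_Sk by auto
      have "(2 * i, 2 * b + 1) \<notin> edges (Sk m)"
        using adj[of i n] IH(1)[of i] i less.prems unfolding n b[unfolded n] by simp
      then have "b = n \<or> b < i"
        using b_rng i less.prems n sub[OF V(1)[of i]] IH(1)[of i] unfolding edges_Sk_even_odd verts_Sk by auto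
      moreover have "\<not> b < i"
        using inj[of "2 * b + 1" "2 * n + 1"] IH(2)[of b] V(2)[of b] V(2)[OF less.prems] b b_rng less.prems n
        by auto
      ultimately have y: "\<phi> (2 * n + 1) = 2 * n + 1" using b by simp
      have e: "(\<phi> (2 * n), 2 * n + 1) \<in> edges (Sk m)" using adj[of n n] less.prems y by simp
      then have "even (\<phi> (2 * n))" using edges_Sk_parity by fastforce
      then obtain a where a: "\<phi> (2 * n) = 2 * a" by (auto elim: evenE)
      have "1 \<le> a" "n = a \<or> a + 2 \<le> n" using e unfolding a edges_Sk_even_odd by auto
      moreover have "\<not> a + 2 \<le> n"
        using inj[of "2 * a" "2 * n"] IH(1)[of a] V(1)[of a] V(1)[OF less.prems] a \<open>1 \<le> a\<close> less.prems n
        by auto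
      ultimately show ?thesis using y a by simp
    qed
  qed
  then show False using fixed[of k] stop k \<open>k \<noteq> m\<close> by simp
qed

text \<open>The white vertices have no edges beyond the path y_1, x_1, y_m, x_m, because x_m and y_1
  are not adjacent.\<close>

lemma Sk_white_edge:
  assumes "3 \<le> m" "u \<in> {2, 3, 2 * m, 2 * m + 1}" "v \<in> {2, 3, 2 * m, 2 * m + 1}"
    and "(u, v) \<in> edges (Sk m)"
  shows "(u, v) \<in> {(2, 3), (3, 2), (2, 2 * m + 1), (2 * m + 1, 2), (2 * m, 2 * m + 1), (2 * m + 1, 2 * m)}"
proof -
  have "(2 * m, 3) \<notin> edges (Sk m)" "(3, 2 * m) \<notin> edges (Sk m)"
    using edges_Sk_even_odd[where i = m and j = 1 and k = m] assms(1) by simp_all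
  moreover have "even u \<noteq> even v" using edges_Sk_parity assms(4) by blast
  ultimately show ?thesis using assms(2-4) by auto
qed

text \<open>The walk \<open>b, a, d, c\<close> never turns back, so it runs through the path
  \<open>y, x, w, z\<close> from one end to the other.\<close>

lemma path_in_4_path:
  assumes "distinct [x, y, z, w]"
    and "(a, b) \<in> {(x, y), (y, x), (x, w), (w, x), (z, w), (w, z)}"
      "(a, d) \<in> {(x, y), (y, x), (x, w), (w, x), (z, w), (w, z)}"
      "(c, d) \<in> {(x, y), (y, x), (x, w), (w, x), (z, w), (w, z)}"
    and "b \<noteq> d" "a \<noteq> c"
  shows "a = x \<and> b = y \<and> c = z \<and> d = w \<or> a = w \<and> b = z \<and> c = y \<and> d = x"
  using assms by auto

lemma Sk_white_path:
  assumes m: "3 \<le> m" and white: "a \<in> {2, 3, 2 * m, 2 * m + 1}" "b \<in> {2, 3, 2 * m, 2 * m + 1}"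
      "c \<in> {2, 3, 2 * m, 2 * m + 1}" "d \<in> {2, 3, 2 * m, 2 * m + 1}"
    and edges: "(a, b) \<in> edges (Sk m)" "(a, d) \<in> edges (Sk m)" "(c, d) \<in> edges (Sk m)"
    and neq: "b \<noteq> d" "a \<noteq> c"
  shows "a = 2 \<and> b = 3 \<and> c = 2 * m \<and> d = 2 * m + 1 \<or> a = 2 * m + 1 \<and> b = 2 * m \<and> c = 3 \<and> d = 2"
proof -
  have "distinct [2, 3, 2 * m, 2 * m + 1]" using m by auto
  from path_in_4_path[OF this Sk_white_edge[OF m white(1,2) edges(1)] Sk_white_edge[OF m white(1,4) edges(2)]
      Sk_white_edge[OF m white(3,4) edges(3)] neq]
  show ?thesis .
qed

lemma Sk_first_edges:
  assumes "2 \<le> k"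
  shows "(2, 3) \<in> edges (Sk k)" "(2 * k, 2 * k + 1) \<in> edges (Sk k)"
    "3 \<le> k \<Longrightarrow> (2, 2 * k + 1) \<in> edges (Sk k)"
  using edges_Sk_even_odd(1)[of 1 1 k] edges_Sk_even_odd(1)[of k k k] edges_Sk_even_odd(1)[of 1 k k] assms
  by simp_all

lemma edges_Sk_2_unique: "(u, v) \<in> edges (Sk 2) \<Longrightarrow> (u, w) \<in> edges (Sk 2) \<Longrightarrow> v = w"
  unfolding Sk_def edges_def by auto presburger+

text \<open>White vertices go to white ones. For \<open>k, m \<ge> 3\<close> they form a path of
  four vertices in both graphs, so the ends match directly or after the flip, and rigidity applies.
  In \<open>Sk 2\<close> they form a matching, which excludes the mixed cases.\<close>

lemma Sk_labelled_incomparable: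
  assumes k: "2 \<le> k" and m: "2 \<le> m" and emb: "embedding (Sk k) (Sk m) \<phi>"
    and lab: "\<And>v. v \<in> verts (Sk k) \<Longrightarrow> Sk_lab k v = Sk_lab m (\<phi> v)"
  shows "k = m"
proof -
  let ?white = "\<lambda>n :: nat. {2, 3, 2 * n, 2 * n + 1}"
  have white_V: "?white k \<subseteq> verts (Sk k)" using k by (auto simp: verts_Sk)
  have white: "\<phi> v \<in> ?white m" if "v \<in> ?white k" for v
    using lab[of v] white_V that unfolding Sk_lab_def by (auto split: if_splits)
  have "inj_on \<phi> (verts (Sk k))" using emb unfolding embedding_def by (rule conjunct1)
  then have inj: "inj_on \<phi> (?white k)" using white_V by (rule inj_on_subset)
  have edge: "(u, v) \<in> edges (Sk k) \<longleftrightarrow> (\<phi> u, \<phi> v) \<in> edges (Sk m)" if "u \<in> ?white k" "v \<in> ?white k" for u v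
    using emb subsetD[OF white_V that(1)] subsetD[OF white_V that(2)] unfolding embedding_def by blast
  consider "k = 2" "m = 2" | "k = 2" "3 \<le> m" | "3 \<le> k" "m = 2" | "3 \<le> k" "3 \<le> m"
    using k m by linarith
  then show ?thesis
  proof cases
    case 1
    then show ?thesis by simp
  next
    case 2
    \<comment> \<open>An injection between sets of size 4 is onto, so the preimage of x_1 would have
      two neighbours in \<open>Sk 2\<close>.\<close>
    have "card (?white k) = 4" "card (?white m) = 4" using 2 by auto
    then have "card (\<phi> ` ?white k) = card (?white m)" using card_image[OF inj] by metis
    moreover have "\<phi> ` ?white k \<subseteq> ?white m" using white by (intro image_subsetI)
    ultimately have "\<phi> ` ?white k = ?white m" by (intro card_subset_eq) simp_all
    then have surj: "\<exists>a\<in>?white k. x = \<phi> a" if "x \<in> ?white m" for x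
      using that by (simp only: image_iff[symmetric])
    obtain a where a: "a \<in> ?white k" "2 = \<phi> a" using surj[of 2] by blast
    obtain b where b: "b \<in> ?white k" "3 = \<phi> b" using surj[of 3] by blast
    obtain c where c: "c \<in> ?white k" "2 * m + 1 = \<phi> c" using surj[of "2 * m + 1"] by blast
    have "(a, b) \<in> edges (Sk k)" "(a, c) \<in> edges (Sk k)"
      using edge[OF a(1) b(1)] edge[OF a(1) c(1)] Sk_first_edges[OF m] 2
      unfolding a(2)[symmetric] b(2)[symmetric] c(2)[symmetric] by blast+
    then have "b = c" using edges_Sk_2_unique 2 by blast
    then show ?thesis using b c 2 by simp
  next
    case 3
    have "(\<phi> 2, \<phi> 3) \<in> edges (Sk 2)" "(\<phi> 2, \<phi> (2 * k + 1)) \<in> edges (Sk 2)"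
      using edge[of 2 3] edge[of 2 "2 * k + 1"] Sk_first_edges[OF k] 3 by simp_all
    then have "\<phi> 3 = \<phi> (2 * k + 1)" by (rule edges_Sk_2_unique)
    then have "3 = 2 * k + 1" using inj by (auto dest: inj_onD)
    then show ?thesis using k by simp
  next
    case 4
    have edges: "(\<phi> 2, \<phi> 3) \<in> edges (Sk m)" "(\<phi> 2, \<phi> (2 * k + 1)) \<in> edges (Sk m)"
      "(\<phi> (2 * k), \<phi> (2 * k + 1)) \<in> edges (Sk m)"
      using edge[of 2 3] edge[of 2 "2 * k + 1"] edge[of "2 * k" "2 * k + 1"] Sk_first_edges[OF k] 4 by simp_all
    have W: "\<phi> 2 \<in> ?white m" "\<phi> 3 \<in> ?white m" "\<phi> (2 * k) \<in> ?white m" "\<phi> (2 * k + 1) \<in> ?white m"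
      using white by blast+
    have neq: "\<phi> 3 \<noteq> \<phi> (2 * k + 1)" "\<phi> 2 \<noteq> \<phi> (2 * k)"
      using inj_on_eq_iff[OF inj, of 3 "2 * k + 1"] inj_on_eq_iff[OF inj, of 2 "2 * k"] k by simp_all
    have "\<phi> 2 = 2 \<and> \<phi> 3 = 3 \<and> \<phi> (2 * k) = 2 * m \<and> \<phi> (2 * k + 1) = 2 * m + 1 \<or>
        \<phi> 2 = 2 * m + 1 \<and> \<phi> 3 = 2 * m \<and> \<phi> (2 * k) = 3 \<and> \<phi> (2 * k + 1) = 2"
      by (rule Sk_white_path[OF 4(2) W edges neq])
    then show ?thesis
    proof
      assume "\<phi> 2 = 2 \<and> \<phi> 3 = 3 \<and> \<phi> (2 * k) = 2 * m \<and> \<phi> (2 * k + 1) = 2 * m + 1"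
      then show ?thesis using embedding_Sk_rigid[OF emb 4] by blast
    next
      assume "\<phi> 2 = 2 * m + 1 \<and> \<phi> 3 = 2 * m \<and> \<phi> (2 * k) = 3 \<and> \<phi> (2 * k + 1) = 2"
      then have "(Sk_flip m \<circ> \<phi>) 2 = 2" "(Sk_flip m \<circ> \<phi>) 3 = 3"
        "(Sk_flip m \<circ> \<phi>) (2 * k) = 2 * m" "(Sk_flip m \<circ> \<phi>) (2 * k + 1) = 2 * m + 1"
        by (simp_all add: Sk_flip_def)
      then show ?thesis
        using embedding_Sk_rigid[OF embedding_compose[OF emb embedding_Sk_flip] 4] by blast
    qed
  qed
qed

text \<open>The family starts at \<open>k = 2\<close> because \<open>Sk 1\<close> is an edge with
  two white ends and embeds into every later member.\<close>

lemma labelled_antichain_Sk: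
  "labelled_antichain bichain_class (UNIV :: colour set) (=) {(Sk k, Sk_lab k) | k. k \<ge> 2}"
  unfolding labelled_antichain_def
proof (intro conjI ballI impI)
  have "inj (\<lambda>k. (Sk k, Sk_lab k))"
  proof (rule injI)
    fix k m assume "(Sk k, Sk_lab k) = (Sk m, Sk_lab m)"
    then have V: "{v. 1 \<le> v div 2 \<and> v div 2 \<le> k} = {v. 1 \<le> v div 2 \<and> v div 2 \<le> m}"
      using verts_Sk by (metis prod.inject)
    have "k \<le> m \<or> k = 0" using V[THEN eqset_imp_iff, of "2 * k"] by auto
    moreover have "m \<le> k \<or> m = 0" using V[THEN eqset_imp_iff, of "2 * m"] by auto
    ultimately show "k = m" by linarith
  qed
  then have "infinite ((\<lambda>k. (Sk k, Sk_lab k)) ` {2..})"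
    using finite_image_iff[OF inj_on_subset[OF _ subset_UNIV]] infinite_Ici by blast
  moreover have "(\<lambda>k. (Sk k, Sk_lab k)) ` {2..} = {(Sk k, Sk_lab k) | k. k \<ge> 2}" by auto
  ultimately show "infinite {(Sk k, Sk_lab k) | k. k \<ge> 2}" by simp
next
  fix a assume "a \<in> {(Sk k, Sk_lab k) | k. k \<ge> 2}"
  then show "case a of (G, l) \<Rightarrow> G \<in> bichain_class \<and> l ` verts G \<subseteq> UNIV"
    using bichain_Sk by (auto simp: bichain_class_def)
next
  fix a b :: "nat graph \<times> (nat \<Rightarrow> colour)"
  assume "a \<in> {(Sk k, Sk_lab k) | k. k \<ge> 2}" "b \<in> {(Sk k, Sk_lab k) | k. k \<ge> 2}" and "a \<noteq> b"
  then obtain k m where k: "a = (Sk k, Sk_lab k)" "2 \<le> k" and m: "b = (Sk m, Sk_lab m)" "2 \<le> m"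
    by blast
  show "\<not> lab_sub (=) a b"
  proof
    assume "lab_sub (=) a b"
    then obtain \<phi> where "embedding (Sk k) (Sk m) \<phi>" "\<And>v. v \<in> verts (Sk k) \<Longrightarrow> Sk_lab k v = Sk_lab m (\<phi> v)"
      unfolding lab_sub_def k m embedding_def case_prod_conv by blast
    then have "k = m" using Sk_labelled_incomparable k m by blast
    then show False using \<open>a \<noteq> b\<close> k m by simp
  qed
qed

theorem theorem19:
  fixes W :: "'w set" and le :: "'w \<Rightarrow> 'w \<Rightarrow> bool"
  shows "labelled_antichain bichain_class (UNIV :: colour set) (=) {(Sk k, Sk_lab k) | k. k \<ge> 2}
    \<and> (\<forall>D. D \<subseteq> bichain_class \<and> hereditary D \<and> finite {k. k \<ge> 2 \<and> Sk k \<in> D}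
           \<longrightarrow> labelled_wqo_wrt D W le)"
proof (intro conjI allI impI)
  show "labelled_antichain bichain_class (UNIV :: colour set) (=) {(Sk k, Sk_lab k) | k. k \<ge> 2}"
    by (rule labelled_antichain_Sk)
  fix D assume D: "D \<subseteq> bichain_class \<and> hereditary D \<and> finite {k. k \<ge> 2 \<and> Sk k \<in> D}"
  \<comment> \<open>Finiteness leaves some \<open>k\<close> with \<open>Sk k\<close> outside
    \<open>D\<close>, and one such \<open>k\<close> suffices.\<close>
  then have "{k. k \<ge> 2 \<and> Sk k \<in> D} \<noteq> {2..}" using infinite_Ici by metis
  then obtain k where "Sk k \<notin> D" by auto
  then show "labelled_wqo_wrt D W le" using labelled_wqo_of_no_Sk D by blast
qed

end
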